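(* Let $N_t$ be the self-exciting point process with rate function $\lambda$ and initial condition $\gamma\ge 0$. Let $x^*$ be any stable fixed point of $\lambda$, i.e. $x^*=\lambda(x^* )$ and $0<\lambda'(x^* )<1$. Then the probability that $\frac{N_t}{t}\to x^*$ as $t\to\infty$ is non-zero: $$\mathbb{P}\left(\lim_{t\to\infty}\frac{N_t}{t}=x^*\right)>0 .$$
   Context: Model: $\lambda:\mathbb{R}_{\ge 0}\to\mathbb{R}_{\ge 0}$ and $\gamma\ge 0$ are given; $N_t$ is a simple point process with empty past history ($N(-\infty,0]=0$) whose intensity at time $t$ with respect to its natural filtration is $\lambda_t=\lambda\left(\frac{N_{t-}+\gamma}{t+1}\right)$. Standing assumptions: $\lambda$ is increasing and continuously differentiable; the equation $x=\lambda(x)$ has finitely many solutions, and each solution $x^*$ satisfies either $\lambda'(x^* )<1$ or $\lambda'(x^* )>1$.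
   Formalization: The formal theorem adds the assumption that λ(γ) > 0 or x* = 0; if λ(γ) = 0 the process almost surely has no points, so N_t/t → 0 and the claim fails for every x* > 0 (e.g. λ(y) = 5y²/(2(1+y²)), γ = 0, x* = 2). *)

theory Defs
  imports "HOL-Probability.Probability"
begin

text \<open>
  A simple point process on the real line is represented by its random set of points
  \<open>X \<omega>\<close>. Simplicity (no multiple points) is built into the representation by a set; the
  points do not accumulate, and the number of points in every interval is a random variable.
\<close>

definition num_points :: "('a \<Rightarrow> real set) \<Rightarrow> real set \<Rightarrow> 'a \<Rightarrow> nat" where
  "num_points X B \<omega> = card (X \<omega> \<inter> B)"

definition simple_point_process :: "'a measure \<Rightarrow> ('a \<Rightarrow> real set) \<Rightarrow> bool" where
  "simple_point_process M X \<longleftrightarrow>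
     (\<forall>\<omega>\<in>space M. \<forall>a b. finite (X \<omega> \<inter> {a<..b})) \<and>
     (\<forall>a b. num_points X {a<..b} \<in> measurable M (count_space UNIV))"

definition natural_filtration :: "'a measure \<Rightarrow> ('a \<Rightarrow> real set) \<Rightarrow> real \<Rightarrow> 'a measure" where
  "natural_filtration M X t =
     sigma (space M) {num_points X {a<..b} -` {n} \<inter> space M | a b n. b \<le> t}"

definition progressively_measurable ::
    "(real \<Rightarrow> 'a measure) \<Rightarrow> (real \<Rightarrow> 'a \<Rightarrow> real) \<Rightarrow> bool" where
  "progressively_measurable F Y \<longleftrightarrow>
     (\<forall>t\<ge>0. (\<lambda>(s, \<omega>). Y s \<omega>)
        \<in> borel_measurable (restrict_space borel {0..t} \<Otimes>\<^sub>M F t))"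

text \<open>The predictable sigma-algebra on \<open>(0, \<infinity>) \<times> \<Omega>\<close>.\<close>

definition predictable_sigma :: "'a set \<Rightarrow> (real \<Rightarrow> 'a measure) \<Rightarrow> (real \<times> 'a) measure" where
  "predictable_sigma \<Omega> F =
     sigma ({0<..} \<times> \<Omega>) {{s<..t} \<times> A | s t A. 0 \<le> s \<and> s \<le> t \<and> A \<in> sets (F s)}"

text \<open>
  Stochastic intensity in the sense of Bremaud (\<open>Point Processes and Queues\<close>, Chapter II):
  \<open>L\<close> is nonnegative, progressive and locally integrable, and
  \<open>E [\<integral> C\<^sub>t dN\<^sub>t] = E [\<integral> C\<^sub>t L\<^sub>t dt]\<close>, with both integrals over \<open>(0, \<infinity>)\<close>, for every
  nonnegative predictable \<open>C\<close>. The integral with respect to \<open>N\<close> is the sum over the points.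
\<close>

definition has_intensity ::
    "'a measure \<Rightarrow> (real \<Rightarrow> 'a measure) \<Rightarrow> ('a \<Rightarrow> real set) \<Rightarrow> (real \<Rightarrow> 'a \<Rightarrow> real) \<Rightarrow> bool" where
  "has_intensity M F X L \<longleftrightarrow>
     (\<forall>t\<ge>0. \<forall>\<omega>\<in>space M. 0 \<le> L t \<omega>) \<and>
     progressively_measurable F L \<and>
     (\<forall>t\<ge>0. AE \<omega> in M. (\<integral>\<^sup>+s\<in>{0..t}. ennreal (L s \<omega>) \<partial>lborel) < \<infinity>) \<and>
     (\<forall>C :: real \<times> 'a \<Rightarrow> ennreal. C \<in> borel_measurable (predictable_sigma (space M) F) \<longrightarrow>
        (\<integral>\<^sup>+\<omega>. (\<integral>\<^sup>+t. C (t, \<omega>) \<partial>count_space (X \<omega> \<inter> {0<..})) \<partial>M) =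
        (\<integral>\<^sup>+\<omega>. (\<integral>\<^sup>+t\<in>{0<..}. C (t, \<omega>) * ennreal (L t \<omega>) \<partial>lborel) \<partial>M))"

text \<open>
  For the locally finite set \<open>X \<omega>\<close>, the left limit \<open>N\<^sub>t\<^sub>-\<close> of \<open>t \<mapsto> N (0, t]\<close> is the number of
  points in the open interval \<open>(0, t)\<close>.
\<close>

definition self_exciting ::
    "'a measure \<Rightarrow> ('a \<Rightarrow> real set) \<Rightarrow> (real \<Rightarrow> real) \<Rightarrow> real \<Rightarrow> bool" where
  "self_exciting M X lam \<gamma> \<longleftrightarrow>
     simple_point_process M X \<and>
     (\<forall>\<omega>\<in>space M. X \<omega> \<inter> {..0} = {}) \<and>
     has_intensity M (natural_filtration M X) X
       (\<lambda>t \<omega>. lam ((real (num_points X {0<..<t} \<omega>) + \<gamma>) / (t + 1)))"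

end

theory Submission
  imports Defs "HOL-Real_Asymp.Real_Asymp"
begin

text \<open>
  Applied to the indicator of \<open>A \<inter> {N\<^sub>u\<^sub>- = n}\<close> on \<open>(s, t]\<close> with \<open>A\<close> in the past of \<open>s\<close>, the
  intensity identity becomes the Kolmogorov forward equation of a pure birth process for the
  masses \<open>P (A \<inter> {N\<^sub>t = n})\<close>; nothing else about the intensity is needed. If \<open>lam \<gamma> > 0\<close>
  it shows that all states have positive mass (state \<open>0\<close> always has, which suffices if
  \<open>x = 0\<close>), so \<open>N\<^sub>T / T\<close> is close to \<open>x\<close> with positive probability for large \<open>T\<close>.
  From there on let \<open>y = (n + \<gamma>) / (t + 1) - x\<close>. Near the stable fixed point the generator maps the
  function \<open>V = (t + 1)\<^sup>\<kappa> (y\<^sup>2 + K / (t + 1))\<close> to something nonpositive, and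
  \<open>\<Psi> = (max 0 (1 - V / c))\<^sup>2\<close> is convex in \<open>V\<close> and vanishes wherever the drift of \<open>V\<close> is not
  controlled. Hence \<open>\<Psi>\<close> is a bounded submartingale, and since it has finite support in \<open>n\<close> this
  follows by differentiating a finite sum. By a maximal inequality \<open>\<Psi>\<close> stays positive at all
  integer times \<open>\<ge> T\<close> with positive probability, and then \<open>y\<^sup>2 = O(t\<^sup>-\<^sup>\<kappa>)\<close>.
\<close>

text \<open>The rank \<open>card (P \<inter> {..<p})\<close> is strictly increasing on
  \<open>P\<close> and stays below \<open>card P\<close>, so it maps \<open>P\<close> bijectively
  onto the numbers below \<open>card P\<close>. It serves to number the points of a path.\<close>

lemma ex_rank:
  fixes P :: "'a::linorder set"
  assumes "finite P" "n < card P"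
  shows "\<exists>p\<in>P. card (P \<inter> {..<p}) = n"
proof -
  let ?r = "\<lambda>p. card (P \<inter> {..<p})"
  have mono: "?r p < ?r q" if "p \<in> P" "p < q" for p q
  proof (rule psubset_card_mono)
    have "p \<in> P \<inter> {..<q} - P \<inter> {..<p}" "P \<inter> {..<p} \<subseteq> P \<inter> {..<q}"
      using that by (simp_all, force)
    then show "P \<inter> {..<p} \<subset> P \<inter> {..<q}" by blast
  qed (use assms in simp)
  have "inj_on ?r P"
  proof (rule inj_onI)
    fix p q assume "p \<in> P" "q \<in> P" "?r p = ?r q"
    then show "p = q" using mono[of p q] mono[of q p] by (metis less_irrefl linorder_neqE)
  qed
  moreover have "?r p < card P" if "p \<in> P" for p
    by (rule psubset_card_mono) (use assms that in auto)
  then have "?r ` P \<subseteq> {..<card P}" by blast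
  ultimately have "?r ` P = {..<card P}"
    by (intro card_subset_eq) (simp_all add: card_image)
  then have "n \<in> ?r ` P" using assms(2) by simp
  then show ?thesis by blast
qed

section \<open>The process and its predictable events\<close>

locale self_exciting_process = prob_space M for M :: "'a measure" +
  fixes X :: "'a \<Rightarrow> real set" and lam :: "real \<Rightarrow> real" and \<gamma> :: real
  assumes \<gamma>_nonneg: "0 \<le> \<gamma>"
    and lam_nonneg: "0 \<le> y \<Longrightarrow> 0 \<le> lam y"
    and lam_mono: "mono_on {0..} lam"
    and lam_cont: "continuous_on {0..} lam"
    and process: "self_exciting M X lam \<gamma>"
begin

abbreviation F :: "real \<Rightarrow> 'a measure" where
  "F \<equiv> natural_filtration M X"

definition N :: "real \<Rightarrow> 'a \<Rightarrow> nat" where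
  "N t = num_points X {0<..t}"

definition N_left :: "real \<Rightarrow> 'a \<Rightarrow> nat" where
  "N_left t = num_points X {0<..<t}"

text \<open>Jump rate in state \<open>n\<close> of a time-inhomogeneous birth chain; the stochastic
  intensity is this rate evaluated at \<open>N_left t\<close>.\<close>

definition rate :: "real \<Rightarrow> nat \<Rightarrow> real" where
  "rate t n = lam ((real n + \<gamma>) / (t + 1))"

lemma finite_points: "\<omega> \<in> space M \<Longrightarrow> finite (X \<omega> \<inter> {a<..b})"
  using process by (auto simp: self_exciting_def simple_point_process_def)

lemma finite_points_open: "\<omega> \<in> space M \<Longrightarrow> finite (X \<omega> \<inter> {a<..<b})"
  by (rule finite_subset[OF _ finite_points[of _ a b]]) auto

lemma num_points_measurable: "num_points X {a<..b} \<in> measurable M (count_space UNIV)"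
  using process by (auto simp: self_exciting_def simple_point_process_def)

lemma N_measurable [measurable]: "N t \<in> measurable M (count_space UNIV)"
  unfolding N_def by (rule num_points_measurable)

lemma N_mono: "\<omega> \<in> space M \<Longrightarrow> s \<le> t \<Longrightarrow> N s \<omega> \<le> N t \<omega>"
  unfolding N_def num_points_def by (intro card_mono finite_points) auto

lemma N_zero: "N 0 \<omega> = 0"
  by (simp add: N_def num_points_def)

lemma rate_nonneg: "0 \<le> t \<Longrightarrow> 0 \<le> rate t n"
  unfolding rate_def using \<gamma>_nonneg by (intro lam_nonneg) auto

lemma rate_cont: "continuous_on {0..} (\<lambda>t. rate t n)"
  unfolding rate_def
  by (rule continuous_on_compose2[OF lam_cont])
     (use \<gamma>_nonneg in \<open>auto intro!: continuous_intros\<close>)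

lemma sets_F: "sets (F t) =
    sigma_sets (space M) {num_points X {a<..b} -` {n} \<inter> space M | a b n. b \<le> t}"
  unfolding natural_filtration_def by (rule sets_measure_of) auto

lemma sets_F_subset: "sets (F t) \<subseteq> sets M"
  unfolding sets_F
  by (intro sets.sigma_sets_subset) (auto intro!: measurable_sets[OF num_points_measurable])

lemma sets_F_mono: "s \<le> t \<Longrightarrow> sets (F s) \<subseteq> sets (F t)"
  unfolding sets_F by (intro sigma_sets_mono') (blast intro: order_trans)

lemma space_F: "space (F t) = space M"
  unfolding natural_filtration_def by (rule space_measure_of) auto

lemma N_measurable_F: "N t \<in> measurable (F t) (count_space UNIV)"
proof (rule measurable_count_space_eq2_countable[THEN iffD2])
  have "N t -` {n} \<inter> space (F t) \<in> sets (F t)" for n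
    unfolding sets_F space_F N_def by (rule sigma_sets.Basic) blast
  then show "N t \<in> space (F t) \<rightarrow> UNIV \<and> (\<forall>a\<in>UNIV. N t -` {a} \<inter> space (F t) \<in> sets (F t))"
    by simp
qed

lemma N_set_F: "{\<omega>\<in>space M. P (N t \<omega>)} \<in> sets (F t)"
proof -
  have "N t -` {n. P n} \<inter> space (F t) \<in> sets (F t)"
    by (rule measurable_sets[OF N_measurable_F]) simp
  also have "N t -` {n. P n} \<inter> space (F t) = {\<omega>\<in>space M. P (N t \<omega>)}"
    by (auto simp: space_F)
  finally show ?thesis .
qed

abbreviation (input) predictable :: "(real \<times> 'a) measure" where
  "predictable \<equiv> predictable_sigma (space M) F"

lemma sets_F_into_space: "A \<in> sets (F s) \<Longrightarrow> A \<subseteq> space M"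
  using sets.sets_into_space space_F by metis

lemma predictable_gen:
  "{{s<..t} \<times> A | s t A. 0 \<le> s \<and> s \<le> t \<and> A \<in> sets (F s)} \<subseteq> Pow ({0<..} \<times> space M)"
  using sets_F_into_space by auto

lemma sets_predictable: "sets predictable =
    sigma_sets ({0<..} \<times> space M) {{s<..t} \<times> A | s t A. 0 \<le> s \<and> s \<le> t \<and> A \<in> sets (F s)}"
  unfolding predictable_sigma_def by (rule sets_measure_of[OF predictable_gen])

lemma predictable_subset: "sets predictable \<subseteq> sets (borel \<Otimes>\<^sub>M M)"
  unfolding sets_predictable
  by (rule sets.sigma_sets_subset') (use sets_F_subset in \<open>auto intro!: pair_measureI\<close>)

lemma predictable_rectangle:
  "0 \<le> s \<Longrightarrow> s \<le> t \<Longrightarrow> A \<in> sets (F s) \<Longrightarrow> {s<..t} \<times> A \<in> sets predictable"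
  unfolding sets_predictable by (rule sigma_sets.Basic) blast

lemma predictable_halfline:
  assumes "0 \<le> s" "A \<in> sets (F s)"
  shows "{s<..} \<times> A \<in> sets predictable"
proof -
  have "\<exists>k::nat. u \<le> s + real k" for u
    using real_arch_simple[of "u - s"] by (simp add: algebra_simps)
  then have "{s<..} \<times> A = (\<Union>k::nat. {s<..s + real k} \<times> A)"
    by auto
  also have "\<dots> \<in> sets predictable"
    by (intro sets.countable_UN'' predictable_rectangle) (use assms in auto)
  finally show ?thesis .
qed

text \<open>Local finiteness leaves a gap between the last point before \<open>u\<close> and
  \<open>u\<close>, and a rational time in that gap has already seen all points of
  \<open>(0, u)\<close>. Quantifying over rationals makes the event a countable union.\<close>

lemma N_left_ge_iff:
  assumes "\<omega> \<in> space M" "0 < u"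
  shows "n \<le> N_left u \<omega> \<longleftrightarrow> (\<exists>q\<in>\<rat>. 0 \<le> q \<and> q < u \<and> n \<le> N q \<omega>)"
proof
  assume n: "n \<le> N_left u \<omega>"
  \<comment> \<open>Inserting \<open>0\<close> makes the set nonempty, so it has a maximum, and
    later yields \<open>0 \<le> q\<close>.\<close>
  let ?P = "insert 0 (X \<omega> \<inter> {0<..<u})"
  have fin: "finite ?P" using finite_points_open[OF assms(1)] by simp
  obtain m where m: "m \<in> ?P" and m_max: "\<And>p. p \<in> ?P \<Longrightarrow> p \<le> m"
    using that[OF Max_in[OF fin] Max_ge[OF fin]] by simp
  from m assms(2) have "m < u" by auto
  then obtain q where q: "q \<in> \<rat>" "m < q" "q < u" using Rats_dense_in_real by meson
  have le: "p \<le> q" if "p \<in> ?P" for p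
    using m_max[OF that] q(2) by linarith
  have "N_left u \<omega> \<le> N q \<omega>"
    unfolding N_left_def N_def num_points_def
    by (intro card_mono finite_points[OF assms(1)]) (use le in \<open>auto\<close>)
  with n have "n \<le> N q \<omega>" by simp
  moreover have "0 \<le> q" using le[of 0] by simp
  ultimately show "\<exists>q\<in>\<rat>. 0 \<le> q \<and> q < u \<and> n \<le> N q \<omega>" using q by blast
next
  assume "\<exists>q\<in>\<rat>. 0 \<le> q \<and> q < u \<and> n \<le> N q \<omega>"
  then obtain q where q: "q < u" "n \<le> N q \<omega>" by auto
  have "N q \<omega> \<le> N_left u \<omega>"
    unfolding N_left_def N_def num_points_def
    using q by (intro card_mono finite_points_open[OF assms(1)]) auto
  with q show "n \<le> N_left u \<omega>" by simp
qed

text \<open>Each rational \<open>q\<close> contributes an event known at time \<open>q\<close>, on a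
  half-line that opens strictly after \<open>q\<close>. This delay is what makes the left limit
  predictable.\<close>

lemma predictable_N_left_ge:
  "{(u, \<omega>). 0 < u \<and> \<omega> \<in> space M \<and> n \<le> N_left u \<omega>} \<in> sets predictable"
proof -
  have "{(u, \<omega>). 0 < u \<and> \<omega> \<in> space M \<and> n \<le> N_left u \<omega>} =
      (\<Union>q\<in>\<rat> \<inter> {0..}. {q<..} \<times> {\<omega>\<in>space M. n \<le> N q \<omega>})"
    (is "?L = ?R")
  proof (rule set_eqI, clarify)
    fix u \<omega>
    have "(u, \<omega>) \<in> ?R \<longleftrightarrow> \<omega> \<in> space M \<and> 0 < u \<and> (\<exists>q\<in>\<rat>. 0 \<le> q \<and> q < u \<and> n \<le> N q \<omega>)"
      by auto
    also have "\<dots> \<longleftrightarrow> (u, \<omega>) \<in> ?L"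
      using N_left_ge_iff by auto
    finally show "(u, \<omega>) \<in> ?L \<longleftrightarrow> (u, \<omega>) \<in> ?R" by simp
  qed
  also have "\<dots> \<in> sets predictable"
    by (intro sets.countable_UN'' countable_Int1 countable_rat predictable_halfline N_set_F) auto
  finally show ?thesis .
qed

text \<open>The test set for the intensity identity: a point of the process in it is the passage of
  the path from \<open>n\<close> to \<open>n + 1\<close>. Equality with \<open>n\<close> is a
  difference of two upper level sets.\<close>

lemma predictable_passage:
  assumes "0 \<le> s" "s \<le> t" "A \<in> sets (F s)"
  shows "{(u, \<omega>). s < u \<and> u \<le> t \<and> \<omega> \<in> A \<and> N_left u \<omega> = n} \<in> sets predictable"
proof -
  have "{(u, \<omega>). s < u \<and> u \<le> t \<and> \<omega> \<in> A \<and> N_left u \<omega> = n} = {s<..t} \<times> A \<inter>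
     ({(u, \<omega>). 0 < u \<and> \<omega> \<in> space M \<and> n \<le> N_left u \<omega>} -
      {(u, \<omega>). 0 < u \<and> \<omega> \<in> space M \<and> Suc n \<le> N_left u \<omega>})"
    using assms sets_F_into_space[OF assms(3)] by auto
  also have "\<dots> \<in> sets predictable"
    by (intro sets.Int sets.Diff predictable_N_left_ge predictable_rectangle assms)
  finally show ?thesis .
qed

lemma intensity_identity:
  assumes "E \<in> sets predictable"
  shows "(\<integral>\<^sup>+\<omega>. (\<integral>\<^sup>+t. indicator E (t, \<omega>) \<partial>count_space (X \<omega> \<inter> {0<..})) \<partial>M) =
    (\<integral>\<^sup>+\<omega>. (\<integral>\<^sup>+t\<in>{0<..}. indicator E (t, \<omega>) * ennreal (rate t (N_left t \<omega>)) \<partial>lborel) \<partial>M)"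
proof -
  have "(indicator E :: _ \<Rightarrow> ennreal) \<in> borel_measurable predictable" using assms by simp
  then show ?thesis
    using process unfolding self_exciting_def has_intensity_def rate_def N_left_def by blast
qed

text \<open>\<open>N_left\<close> numbers the points, and the point with number \<open>n\<close>
  lifts the count to \<open>n + 1\<close>. At most one point has that number, and it lies in
  \<open>(s, t]\<close> exactly if \<open>N s \<le> n < N t\<close>.\<close>

lemma count_passage:
  assumes "\<omega> \<in> space M" "0 \<le> s" "s \<le> t"
  shows "(\<integral>\<^sup>+u. indicator {u. s < u \<and> u \<le> t \<and> N_left u \<omega> = n} u \<partial>count_space (X \<omega> \<inter> {0<..}))
    = (if N s \<omega> \<le> n \<and> n < N t \<omega> then 1 else 0 :: ennreal)"
proof -
  have less: "N_left q \<omega> < N_left q' \<omega>" if "q \<in> X \<omega>" "0 < q" "q < q'" for q q'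
    unfolding N_left_def num_points_def
  proof (rule psubset_card_mono[OF finite_points_open[OF assms(1)]])
    have "q \<notin> X \<omega> \<inter> {0<..<q}" "q \<in> X \<omega> \<inter> {0<..<q'}" "X \<omega> \<inter> {0<..<q} \<subseteq> X \<omega> \<inter> {0<..<q'}"
      using that by auto
    then show "X \<omega> \<inter> {0<..<q} \<subset> X \<omega> \<inter> {0<..<q'}" by blast
  qed
  have less': "N_left q \<omega> < N r \<omega>" if "q \<in> X \<omega>" "0 < q" "q \<le> r" for q r
    unfolding N_left_def N_def num_points_def
  proof (rule psubset_card_mono[OF finite_points[OF assms(1)]])
    have "q \<notin> X \<omega> \<inter> {0<..<q}" "q \<in> X \<omega> \<inter> {0<..r}" "X \<omega> \<inter> {0<..<q} \<subseteq> X \<omega> \<inter> {0<..r}"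
      using that by auto
    then show "X \<omega> \<inter> {0<..<q} \<subset> X \<omega> \<inter> {0<..r}" by blast
  qed
  show ?thesis
proof (cases "N s \<omega> \<le> n \<and> n < N t \<omega>")
  case True
  let ?P = "X \<omega> \<inter> {0<..t}"
  have rank: "card (?P \<inter> {..<p}) = N_left p \<omega>" if "p \<in> ?P" for p
    unfolding N_left_def num_points_def using that by (intro arg_cong[where f = card]) auto
  have "\<exists>p\<in>?P. card (?P \<inter> {..<p}) = n"
    using True by (intro ex_rank finite_points[OF assms(1)]) (simp add: N_def num_points_def)
  then obtain p where p: "p \<in> ?P" "N_left p \<omega> = n"
    using rank by auto
  have "s < p"
  proof (rule ccontr)
    assume "\<not> s < p"
    then have "N_left p \<omega> < N s \<omega>" using p by (intro less') auto
    with True p show False by simp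
  qed
  have "(\<integral>\<^sup>+u. indicator {u. s < u \<and> u \<le> t \<and> N_left u \<omega> = n} u \<partial>count_space (X \<omega> \<inter> {0<..}))
     = (\<Sum>u\<in>{p}. indicator {u. s < u \<and> u \<le> t \<and> N_left u \<omega> = n} u :: ennreal)"
  proof (rule nn_integral_count_space')
    fix q assume q: "q \<in> X \<omega> \<inter> {0<..}" "q \<notin> {p}"
    have "N_left q \<omega> \<noteq> n"
      using less[of p q] less[of q p] p q by (cases "p < q") auto
    then show "indicator {u. s < u \<and> u \<le> t \<and> N_left u \<omega> = n} q = (0::ennreal)" by simp
  qed (use p in auto)
  then show ?thesis using True p \<open>s < p\<close> by simp
next
  case False
  have "\<not> (s < u \<and> u \<le> t \<and> N_left u \<omega> = n)" if "u \<in> X \<omega> \<inter> {0<..}" for u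
  proof
    assume u: "s < u \<and> u \<le> t \<and> N_left u \<omega> = n"
    then have "N s \<omega> \<le> n"
      unfolding N_left_def N_def num_points_def
      by (auto intro!: card_mono finite_points_open[OF assms(1)])
    moreover have "N_left u \<omega> < N t \<omega>" using u that by (intro less') auto
    ultimately show False using False u by simp
  qed
  then have "(\<integral>\<^sup>+u. indicator {u. s < u \<and> u \<le> t \<and> N_left u \<omega> = n} u
      \<partial>count_space (X \<omega> \<inter> {0<..})) = (\<integral>\<^sup>+u. 0 \<partial>count_space (X \<omega> \<inter> {0<..}))"
    by (intro nn_integral_cong) auto
  with False show ?thesis by simp
qed
qed

section \<open>The forward equation\<close>

text \<open>Sections of predictable sets at a fixed time are measurable, so the upper level sets of
  \<open>N_left u\<close> are events.\<close>

lemma N_left_measurable [measurable]: "N_left u \<in> measurable M (count_space UNIV)" if "0 < u"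
proof (rule measurable_count_space_eq2_countable[THEN iffD2])
  have ge: "{\<omega>\<in>space M. n \<le> N_left u \<omega>} \<in> sets M" for n
  proof -
    have "Pair u -` {(u, \<omega>). 0 < u \<and> \<omega> \<in> space M \<and> n \<le> N_left u \<omega>} \<in> sets M"
      using predictable_N_left_ge predictable_subset by (intro sets_Pair1[where ?M1.0 = borel]) auto
    then show ?thesis using that by (simp add: vimage_def)
  qed
  have "N_left u -` {n} \<inter> space M \<in> sets M" for n
  proof -
    have "N_left u -` {n} \<inter> space M =
        {\<omega>\<in>space M. n \<le> N_left u \<omega>} - {\<omega>\<in>space M. Suc n \<le> N_left u \<omega>}" by auto
    with ge[of n] ge[of "Suc n"] show ?thesis by simp
  qed
  then show "N_left u \<in> space M \<rightarrow> UNIV \<and> (\<forall>a\<in>UNIV. N_left u -` {a} \<inter> space M \<in> sets M)"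
    by simp
qed

text \<open>This is the intensity identity for the deterministic predictable set \<open>{u} \<times> \<Omega>\<close>.\<close>

lemma AE_N_left_eq:
  assumes "0 < u"
  shows "AE \<omega> in M. N_left u \<omega> = N u \<omega>"
proof -
  \<comment> \<open>The generators are half-open in time, so a single time is reached as a countable
    intersection of intervals \<open>(q, u]\<close>.\<close>
  have "{u} \<times> space M = (\<Inter>q\<in>\<rat> \<inter> {0..<u}. {q<..u} \<times> space M)"
  proof (rule set_eqI, clarify)
    fix v and \<omega> :: 'a
    \<comment> \<open>\<open>q0\<close> forces \<open>0 < v\<close>, so the rational found between
      \<open>v\<close> and \<open>u\<close> is nonnegative, as the index set demands.\<close>
    obtain q0 :: real where q0: "q0 \<in> \<rat>" "0 < q0" "q0 < u"
      using Rats_dense_in_real[OF assms] by auto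
    have "v = u" if "\<And>q. q \<in> \<rat> \<Longrightarrow> 0 \<le> q \<Longrightarrow> q < u \<Longrightarrow> q < v \<and> v \<le> u"
    proof (rule ccontr)
      assume "v \<noteq> u"
      then have "v < u" "0 < v" using that[OF q0(1)] q0 by auto
      then obtain q where "q \<in> \<rat>" "v < q" "q < u" using Rats_dense_in_real by meson
      with that[of q] \<open>0 < v\<close> show False by auto
    qed
    then show "(v, \<omega>) \<in> {u} \<times> space M \<longleftrightarrow>
        (v, \<omega>) \<in> (\<Inter>q\<in>\<rat> \<inter> {0..<u}. {q<..u} \<times> space M)"
      using q0 by auto
  qed
  also have "\<dots> \<in> sets predictable"
  proof (rule sets.countable_INT')
    show "countable (\<rat> \<inter> {0..<u})" by (intro countable_Int1 countable_rat)
    show "\<rat> \<inter> {0..<u} \<noteq> {}" using assms Rats_0 by force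
    have "space M \<in> sets (F q)" for q using sets.top[of "F q"] by (simp add: space_F)
    then show "(\<lambda>q. {q<..u} \<times> space M) ` (\<rat> \<inter> {0..<u}) \<subseteq> sets predictable"
      by (auto intro!: predictable_rectangle)
  qed
  finally have "{u} \<times> space M \<in> sets predictable" .
  note intensity_identity[OF this]
  also have "(\<integral>\<^sup>+\<omega>. (\<integral>\<^sup>+t\<in>{0<..}. indicator ({u} \<times> space M) (t, \<omega>) *
      ennreal (rate t (N_left t \<omega>)) \<partial>lborel) \<partial>M) = (\<integral>\<^sup>+\<omega>. 0 \<partial>M)"
  proof (rule nn_integral_cong)
    fix \<omega>
    have "(\<integral>\<^sup>+t\<in>{0<..}. indicator ({u} \<times> space M) (t, \<omega>) *
        ennreal (rate t (N_left t \<omega>)) \<partial>lborel) = (\<integral>\<^sup>+t. 0 \<partial>(lborel :: real measure))"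
      by (rule nn_integral_cong_AE, rule AE_mp[OF AE_lborel_singleton[of u]]) simp
    then show "(\<integral>\<^sup>+t\<in>{0<..}. indicator ({u} \<times> space M) (t, \<omega>) *
        ennreal (rate t (N_left t \<omega>)) \<partial>lborel) = 0" by simp
  qed
  finally have zero: "(\<integral>\<^sup>+\<omega>. (\<integral>\<^sup>+t. indicator ({u} \<times> space M) (t, \<omega>)
      \<partial>count_space (X \<omega> \<inter> {0<..})) \<partial>M) = 0" by simp
  have meas: "{\<omega>\<in>space M. N_left u \<omega> \<noteq> N u \<omega>} \<in> sets M"
  proof -
    have "{\<omega>\<in>space M. N_left u \<omega> \<noteq> N u \<omega>} =
        (\<Union>n. (N_left u -` {n} \<inter> space M) \<inter> (N u -` (- {n}) \<inter> space M))" by auto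
    also have "\<dots> \<in> sets M"
      by (intro sets.countable_UN'' sets.Int measurable_sets[OF N_left_measurable[OF assms]]
        measurable_sets[OF N_measurable]) auto
    finally show ?thesis .
  qed
  have "emeasure M {\<omega>\<in>space M. N_left u \<omega> \<noteq> N u \<omega>} =
      (\<integral>\<^sup>+\<omega>. indicator {\<omega>\<in>space M. N_left u \<omega> \<noteq> N u \<omega>} \<omega> \<partial>M)"
    using meas by simp
  \<comment> \<open>Where the two counts differ, \<open>u\<close> is itself a point, so the inner
    integral is \<open>1\<close>.\<close>
  also have "\<dots> \<le> (\<integral>\<^sup>+\<omega>. (\<integral>\<^sup>+t. indicator ({u} \<times> space M) (t, \<omega>)
      \<partial>count_space (X \<omega> \<inter> {0<..})) \<partial>M)"
  proof (rule nn_integral_mono)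
    fix \<omega> assume \<omega>: "\<omega> \<in> space M"
    show "indicator {\<omega>\<in>space M. N_left u \<omega> \<noteq> N u \<omega>} \<omega> \<le>
       (\<integral>\<^sup>+t. indicator ({u} \<times> space M) (t, \<omega>) \<partial>count_space (X \<omega> \<inter> {0<..}))"
    proof (cases "u \<in> X \<omega>")
      case True
      have "(\<integral>\<^sup>+t. indicator ({u} \<times> space M) (t, \<omega>) \<partial>count_space (X \<omega> \<inter> {0<..})) =
          (\<Sum>t\<in>{u}. indicator ({u} \<times> space M) (t, \<omega>) :: ennreal)"
        using True assms by (intro nn_integral_count_space') auto
      with \<omega> show ?thesis by (simp add: indicator_def)
    next
      case False
      have "X \<omega> \<inter> {0<..<u} = X \<omega> \<inter> {0<..u}" using False by (auto simp: order.order_iff_strict)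
      then have "N_left u \<omega> = N u \<omega>" by (simp add: N_left_def N_def num_points_def)
      then show ?thesis by simp
    qed
  qed
  finally have "emeasure M {\<omega>\<in>space M. N_left u \<omega> \<noteq> N u \<omega>} = 0" using zero by simp
  with meas show ?thesis by (intro AE_I[OF _ _ meas]) auto
qed

section \<open>Masses and tails of the count on an event of the past\<close>

definition mass :: "'a set \<Rightarrow> nat \<Rightarrow> real \<Rightarrow> real" where
  "mass A n t = prob {\<omega>\<in>A. N t \<omega> = n}"

text \<open>Tails are the convenient unknowns: they are nondecreasing in time and change only
  through passages from \<open>n\<close> to \<open>n + 1\<close>. Masses are differences of
  consecutive tails, with \<open>prob A\<close> in front of \<open>tail A 0\<close>.\<close>

definition tail :: "'a set \<Rightarrow> nat \<Rightarrow> real \<Rightarrow> real" where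
  "tail A n t = prob {\<omega>\<in>A. n < N t \<omega>}"

lemma restrict_event: "{\<omega>\<in>A. P (N s \<omega>) (N t \<omega>)} \<in> sets M" if "A \<in> sets M"
proof -
  have "{\<omega>\<in>A. P (N s \<omega>) (N t \<omega>)} = A \<inter> {\<omega>\<in>space M. P (N s \<omega>) (N t \<omega>)}"
    using sets.sets_into_space[OF that] by auto
  also have "\<dots> \<in> sets M" using that by measurable
  finally show ?thesis .
qed

lemma mass_0:
  assumes "A \<in> sets M"
  shows "mass A 0 t = prob A - tail A 0 t"
proof -
  have "prob ({\<omega>\<in>A. N t \<omega> = 0} \<union> {\<omega>\<in>A. 0 < N t \<omega>}) = mass A 0 t + tail A 0 t"
    unfolding mass_def tail_def
    using restrict_event[OF assms, of "\<lambda>_ n. n = 0" t t] restrict_event[OF assms, of "\<lambda>_ n. 0 < n" t t]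
    by (intro finite_measure_Union) auto
  also have "{\<omega>\<in>A. N t \<omega> = 0} \<union> {\<omega>\<in>A. 0 < N t \<omega>} = A" by auto
  finally show ?thesis by simp
qed

lemma mass_Suc:
  assumes "A \<in> sets M"
  shows "mass A (Suc n) t = tail A n t - tail A (Suc n) t"
proof -
  have "prob ({\<omega>\<in>A. N t \<omega> = Suc n} \<union> {\<omega>\<in>A. Suc n < N t \<omega>}) = mass A (Suc n) t + tail A (Suc n) t"
    unfolding mass_def tail_def
    using restrict_event[OF assms, of "\<lambda>_ m. m = Suc n" t t]
      restrict_event[OF assms, of "\<lambda>_ m. Suc n < m" t t]
    by (intro finite_measure_Union) auto
  also have "{\<omega>\<in>A. N t \<omega> = Suc n} \<union> {\<omega>\<in>A. Suc n < N t \<omega>} = {\<omega>\<in>A. n < N t \<omega>}" by auto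
  finally show ?thesis by (simp add: tail_def)
qed

lemma tail_mono: "A \<in> sets M \<Longrightarrow> mono (tail A n)"
  unfolding tail_def using sets.sets_into_space[of A M]
  by (intro monoI finite_measure_mono restrict_event[of A "\<lambda>_ m. n < m"])
     (auto intro: less_le_trans[OF _ N_mono])

text \<open>Differences of monotone functions are Borel; this is available before any continuity in
  time is known.\<close>

lemma mass_borel: "A \<in> sets M \<Longrightarrow> mass A n \<in> borel_measurable borel"
proof (cases n)
  case 0
  assume "A \<in> sets M"
  then have "mass A n = (\<lambda>t. prob A - tail A 0 t)" "tail A 0 \<in> borel_measurable borel"
    using 0 by (auto simp: mass_0 borel_measurable_mono tail_mono)
  then show ?thesis by simp
next
  case (Suc m)
  assume "A \<in> sets M"
  then have "mass A n = (\<lambda>t. tail A m t - tail A (Suc m) t)"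
    "tail A m \<in> borel_measurable borel" "tail A (Suc m) \<in> borel_measurable borel"
    using Suc by (auto simp: mass_Suc borel_measurable_mono tail_mono)
  then show ?thesis by simp
qed

lemma mass_nonneg: "0 \<le> mass A n t"
  by (simp add: mass_def)

text \<open>Both sides of the intensity identity are evaluated on the passage set. The sum over the
  points is \<open>0\<close> or \<open>1\<close>; on the other side the random intensity equals the
  deterministic \<open>rate u n\<close>, so Fubini leaves that rate times a probability.
  \<open>AE_N_left_eq\<close> replaces \<open>N_left u\<close> by \<open>N u\<close>.\<close>

lemma emeasure_passage:
  assumes A: "A \<in> sets (F s)" and s: "0 \<le> s" "s \<le> t"
  shows "emeasure M {\<omega>\<in>A. N s \<omega> \<le> n \<and> n < N t \<omega>} =
    (\<integral>\<^sup>+u. ennreal (indicator {s<..t} u * (rate u n * mass A n u)) \<partial>lborel)"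
proof -
  have AM: "A \<in> sets M" using A sets_F_subset by blast
  define E where "E = {(u, \<omega>). s < u \<and> u \<le> t \<and> \<omega> \<in> A \<and> N_left u \<omega> = n}"
  have E: "E \<in> sets predictable" unfolding E_def by (rule predictable_passage[OF s A])
  have [measurable]: "E \<in> sets (lborel \<Otimes>\<^sub>M M)"
    using E predictable_subset by (auto cong: sets_pair_measure_cong)
  \<comment> \<open>\<open>lam\<close> is controlled only on \<open>{0..}\<close>. Cutting at time
    \<open>0\<close> gives global measurability and changes nothing on \<open>E\<close>, whose times
    exceed \<open>s \<ge> 0\<close>.\<close>
  have r: "(\<lambda>u. indicator {0..} u *\<^sub>R rate u n) \<in> borel_measurable borel"
    by (rule borel_measurable_continuous_on_indicator[OF _ rate_cont]) simp
  then have [measurable]: "(\<lambda>u. indicator {0..} u * rate u n) \<in> borel_measurable borel"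
    by simp
  interpret pair_sigma_finite lborel M ..
  have "emeasure M {\<omega>\<in>A. N s \<omega> \<le> n \<and> n < N t \<omega>} =
      (\<integral>\<^sup>+\<omega>. indicator {\<omega>\<in>A. N s \<omega> \<le> n \<and> n < N t \<omega>} \<omega> \<partial>M)"
    using restrict_event[OF AM, of "\<lambda>i j. i \<le> n \<and> n < j"] by simp
  also have "\<dots> = (\<integral>\<^sup>+\<omega>. (\<integral>\<^sup>+u. indicator E (u, \<omega>) \<partial>count_space (X \<omega> \<inter> {0<..})) \<partial>M)"
  proof (rule nn_integral_cong)
    fix \<omega> assume \<omega>: "\<omega> \<in> space M"
    show "indicator {\<omega>\<in>A. N s \<omega> \<le> n \<and> n < N t \<omega>} \<omega> =
      (\<integral>\<^sup>+u. indicator E (u, \<omega>) \<partial>count_space (X \<omega> \<inter> {0<..}))"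
    proof (cases "\<omega> \<in> A")
      case True
      then have "(\<integral>\<^sup>+u. indicator E (u, \<omega>) \<partial>count_space (X \<omega> \<inter> {0<..})) =
        (\<integral>\<^sup>+u. indicator {u. s < u \<and> u \<le> t \<and> N_left u \<omega> = n} u
          \<partial>count_space (X \<omega> \<inter> {0<..}))"
        by (intro nn_integral_cong) (simp add: E_def indicator_def)
      also note count_passage[OF \<omega> s]
      finally show ?thesis using True by (simp add: indicator_def)
    qed (simp add: E_def indicator_def)
  qed
  also have "\<dots> = (\<integral>\<^sup>+\<omega>. (\<integral>\<^sup>+t\<in>{0<..}. indicator E (t, \<omega>) *
      ennreal (rate t (N_left t \<omega>)) \<partial>lborel) \<partial>M)"
    by (rule intensity_identity[OF E])
  also have "\<dots> = (\<integral>\<^sup>+\<omega>. (\<integral>\<^sup>+u. indicator E (u, \<omega>) *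
      ennreal (indicator {0..} u * rate u n) \<partial>lborel) \<partial>M)"
    using s by (intro nn_integral_cong) (auto simp: E_def indicator_def)
  also have "\<dots> = (\<integral>\<^sup>+u. (\<integral>\<^sup>+\<omega>. indicator E (u, \<omega>) *
      ennreal (indicator {0..} u * rate u n) \<partial>M) \<partial>lborel)"
    by (rule Fubini') measurable
  also have "\<dots> = (\<integral>\<^sup>+u. ennreal (indicator {s<..t} u * (rate u n * mass A n u)) \<partial>lborel)"
  proof (rule nn_integral_cong)
    fix u :: real
    show "(\<integral>\<^sup>+\<omega>. indicator E (u, \<omega>) * ennreal (indicator {0..} u * rate u n) \<partial>M) =
      ennreal (indicator {s<..t} u * (rate u n * mass A n u))"
    proof (cases "u \<in> {s<..t}")
      case True
      then have u: "0 < u" using s by simp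
      have ev: "{\<omega>\<in>A. N u \<omega> = n} \<in> sets M"
        using restrict_event[OF AM, of "\<lambda>_ m. m = n"] by simp
      have "(\<integral>\<^sup>+\<omega>. indicator E (u, \<omega>) * ennreal (indicator {0..} u * rate u n) \<partial>M) =
         (\<integral>\<^sup>+\<omega>. ennreal (rate u n) * indicator {\<omega>\<in>A. N u \<omega> = n} \<omega> \<partial>M)"
        using AE_N_left_eq[OF u]
        by (intro nn_integral_cong_AE, elim AE_mp, intro AE_I2)
           (use True u in \<open>auto simp: E_def indicator_def\<close>)
      also have "\<dots> = ennreal (rate u n) * emeasure M {\<omega>\<in>A. N u \<omega> = n}"
        using ev by (rule nn_integral_cmult_indicator)
      also have "\<dots> = ennreal (rate u n * mass A n u)"
        using rate_nonneg[of u n] u by (simp add: mass_def emeasure_eq_measure ennreal_mult)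
      finally show ?thesis using True by simp
    qed (auto simp: E_def indicator_def)
  qed
  finally show ?thesis .
qed

text \<open>On \<open>A\<close>, the event \<open>n < N t\<close> is the disjoint union of
  \<open>n < N s\<close> and the passage event, so the increment of the tail is the probability
  computed in \<open>emeasure_passage\<close>.\<close>

lemma tail_has_integral:
  assumes A: "A \<in> sets (F s)" and s: "0 \<le> s" "s \<le> t"
  shows "((\<lambda>u. rate u n * mass A n u) has_integral (tail A n t - tail A n s)) {s..t}"
proof -
  have AM: "A \<in> sets M" using A sets_F_subset by blast
  let ?P = "{\<omega>\<in>A. N s \<omega> \<le> n \<and> n < N t \<omega>}"
  let ?f = "\<lambda>u. indicator {s<..t} u * (rate u n * mass A n u)"
  have "prob ({\<omega>\<in>A. n < N s \<omega>} \<union> ?P) = tail A n s + prob ?P"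
    unfolding tail_def
    using restrict_event[OF AM, of "\<lambda>i j. i \<le> n \<and> n < j" s t] restrict_event[OF AM, of "\<lambda>i _. n < i" s t]
    by (intro finite_measure_Union) auto
  also have "{\<omega>\<in>A. n < N s \<omega>} \<union> ?P = {\<omega>\<in>A. n < N t \<omega>}"
    using N_mono[OF _ s(2)] sets.sets_into_space[OF AM] by (force simp: not_less)
  finally have tail: "tail A n t - tail A n s = prob ?P" by (simp add: tail_def)
  have "(\<lambda>u. indicator {0..} u *\<^sub>R rate u n) \<in> borel_measurable borel"
    by (rule borel_measurable_continuous_on_indicator[OF _ rate_cont]) simp
  then have [measurable]: "(\<lambda>u. indicator {0..} u * rate u n) \<in> borel_measurable borel"
    by simp
  have [measurable]: "mass A n \<in> borel_measurable borel" by (rule mass_borel[OF AM])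
  have "?f = (\<lambda>u. indicator {s<..t} u * ((indicator {0..} u * rate u n) * mass A n u))"
    using s by (auto simp: indicator_def)
  then have "?f \<in> borel_measurable borel" by simp
  moreover have "0 \<le> ?f u" for u
    using rate_nonneg[of u n] mass_nonneg[of A n u] s by (auto simp: indicator_def)
  moreover have "(\<integral>\<^sup>+u. ennreal (?f u) \<partial>lborel) = ennreal (prob ?P)"
    using emeasure_passage[OF A s, of n] by (simp add: emeasure_eq_measure)
  ultimately have "(?f has_integral prob ?P) UNIV"
    by (intro nn_integral_has_integral) auto
  also have "?f = (\<lambda>u. if u \<in> {s<..t} then rate u n * mass A n u else 0)"
    by (auto simp: indicator_def)
  finally have "((\<lambda>u. rate u n * mass A n u) has_integral prob ?P) {s<..t}"
    by (simp only: has_integral_restrict_UNIV)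
  moreover have "((\<lambda>u. rate u n * mass A n u) has_integral prob ?P) {s<..t} \<longleftrightarrow>
      ((\<lambda>u. rate u n * mass A n u) has_integral prob ?P) {s..t}"
    by (rule has_integral_spike_set_eq) (auto intro!: negligible_subset[OF negligible_sing[of s]])
  ultimately show ?thesis by (simp only: tail)
qed

text \<open>Start of a bootstrap: integrability makes the tails continuous, hence the masses; then
  the integrand is continuous and the tails are differentiable.\<close>

lemma tail_continuous:
  assumes A: "A \<in> sets (F s)" and s: "0 \<le> s"
  shows "continuous_on {s..b} (tail A n)"
proof (cases "s \<le> b")
  case True
  have "continuous_on {s..b} (\<lambda>t. tail A n s + integral {s..t} (\<lambda>u. rate u n * mass A n u))"
    using tail_has_integral[OF A s True]
    by (intro continuous_intros indefinite_integral_continuous_1) (auto simp: integrable_on_def)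
  moreover have "tail A n s + integral {s..t} (\<lambda>u. rate u n * mass A n u) = tail A n t"
    if "t \<in> {s..b}" for t
    using integral_unique[OF tail_has_integral[OF A s, of t]] that by simp
  ultimately show ?thesis by (subst (asm) continuous_on_cong) auto
qed simp

lemma mass_continuous:
  assumes A: "A \<in> sets (F s)" and s: "0 \<le> s"
  shows "continuous_on {s..b} (mass A n)"
proof -
  have AM: "A \<in> sets M" using A sets_F_subset by blast
  show ?thesis
  proof (cases n)
    case 0
    then have "mass A n = (\<lambda>t. prob A - tail A 0 t)" by (simp add: mass_0[OF AM] fun_eq_iff)
    then show ?thesis by (simp add: continuous_intros tail_continuous[OF assms])
  next
    case (Suc m)
    then have "mass A n = (\<lambda>t. tail A m t - tail A (Suc m) t)"
      by (simp add: mass_Suc[OF AM] fun_eq_iff)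
    then show ?thesis by (simp add: continuous_intros tail_continuous[OF assms])
  qed
qed

lemma tail_deriv:
  assumes A: "A \<in> sets (F s)" and s: "0 \<le> s" and u: "u \<in> {s..b}"
  shows "(tail A n has_real_derivative rate u n * mass A n u) (at u within {s..b})"
proof -
  have "continuous_on {s..b} (\<lambda>u. rate u n * mass A n u)"
    by (intro continuous_intros mass_continuous[OF A s] continuous_on_subset[OF rate_cont])
       (use s in auto)
  then have "((\<lambda>t. tail A n s + integral {s..t} (\<lambda>u. rate u n * mass A n u))
      has_real_derivative 0 + rate u n * mass A n u) (at u within {s..b})"
    by (intro DERIV_add DERIV_const integral_has_real_derivative[OF _ u])
  then have "((\<lambda>t. tail A n s + integral {s..t} (\<lambda>u. rate u n * mass A n u))
      has_real_derivative rate u n * mass A n u) (at u within {s..b})" by simp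
  then show ?thesis
  proof (rule has_field_derivative_transform_within[OF _ zero_less_one u])
    fix t assume "t \<in> {s..b}"
    then show "tail A n s + integral {s..t} (\<lambda>u. rate u n * mass A n u) = tail A n t"
      using integral_unique[OF tail_has_integral[OF A s, of t]] by simp
  qed
qed

text \<open>The derivatives of consecutive tails are the flows into and out of state
  \<open>n\<close>; state \<open>0\<close> has no inflow.\<close>

lemma kolmogorov_forward:
  assumes A: "A \<in> sets (F s)" and s: "0 \<le> s" and u: "u \<in> {s..b}"
  shows "(mass A n has_real_derivative
    (if n = 0 then 0 else rate u (n - 1) * mass A (n - 1) u) - rate u n * mass A n u)
      (at u within {s..b})"
proof -
  have AM: "A \<in> sets M" using A sets_F_subset by blast
  show ?thesis
  proof (cases n)
    case 0
    then have "mass A n = (\<lambda>t. prob A - tail A 0 t)" by (simp add: mass_0[OF AM] fun_eq_iff)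
    then show ?thesis using 0 by (auto intro!: derivative_eq_intros tail_deriv[OF assms])
  next
    case (Suc m)
    then have "mass A n = (\<lambda>t. tail A m t - tail A (Suc m) t)"
      by (simp add: mass_Suc[OF AM] fun_eq_iff)
    then show ?thesis using Suc by (auto intro!: derivative_eq_intros tail_deriv[OF assms])
  qed
qed

end

section \<open>The truncated Lyapunov function\<close>

text \<open>Squaring makes the positive part continuously differentiable at \<open>1\<close>; the
  function is convex and nonincreasing.\<close>

definition cutoff :: "real \<Rightarrow> real" where
  "cutoff y = (max 0 (1 - y))\<^sup>2"

text \<open>Comparison with the tangent line at \<open>a\<close>. The lower bound is convexity and
  drives the drift inequality; the quadratic upper bound yields the derivative.\<close>

lemma cutoff_taylor:
  "0 \<le> cutoff b - cutoff a + 2 * max 0 (1 - a) * (b - a)"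
  "cutoff b - cutoff a + 2 * max 0 (1 - a) * (b - a) \<le> (b - a)\<^sup>2"
proof -
  have sq: "0 \<le> (b - a)\<^sup>2" "0 \<le> (1 - a)\<^sup>2" "0 \<le> (1 - b)\<^sup>2" by simp_all
  have "0 \<le> cutoff b - cutoff a + 2 * max 0 (1 - a) * (b - a) \<and>
    cutoff b - cutoff a + 2 * max 0 (1 - a) * (b - a) \<le> (b - a)\<^sup>2"
  proof (cases "a < 1"; cases "b < 1")
    assume "a < 1" "b < 1"
    then show ?thesis using sq by (simp add: cutoff_def power2_eq_square algebra_simps)
  next
    assume "a < 1" "\<not> b < 1"
    then have "0 \<le> (1 - a) * (b - 1)" by simp
    with \<open>a < 1\<close> \<open>\<not> b < 1\<close> sq show ?thesis
      by (simp add: cutoff_def power2_eq_square algebra_simps)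
  next
    assume "\<not> a < 1" "b < 1"
    then have "(1 - b)\<^sup>2 \<le> (a - b)\<^sup>2" by (intro power_mono) auto
    with \<open>\<not> a < 1\<close> \<open>b < 1\<close> sq show ?thesis by (simp add: cutoff_def power2_commute[of b a])
  qed (simp add: cutoff_def)
  then show "0 \<le> cutoff b - cutoff a + 2 * max 0 (1 - a) * (b - a)"
    "cutoff b - cutoff a + 2 * max 0 (1 - a) * (b - a) \<le> (b - a)\<^sup>2" by blast+
qed

lemma cutoff_deriv: "(cutoff has_real_derivative - 2 * max 0 (1 - a)) (at a)"
  unfolding DERIV_def
proof (rule LIM_zero_cancel, rule Lim_null_comparison)
  show "\<forall>\<^sub>F e in at 0. norm ((cutoff (a + e) - cutoff a) / e - - 2 * max 0 (1 - a)) \<le> \<bar>e\<bar>"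
  proof (rule eventually_at_filter[THEN iffD2], rule always_eventually, intro allI impI)
    fix e :: real assume e: "e \<noteq> 0"
    have "(cutoff (a + e) - cutoff a) / e - - 2 * max 0 (1 - a)
        = (cutoff (a + e) - cutoff a + 2 * max 0 (1 - a) * e) / e"
      using e by (simp add: field_simps)
    also have "norm \<dots> \<le> e\<^sup>2 / \<bar>e\<bar>"
      using cutoff_taylor[of "a + e" a] by (simp add: divide_right_mono)
    also have "\<dots> = \<bar>e\<bar>" using e by (simp add: power2_eq_square field_simps abs_if)
    finally show "norm ((cutoff (a + e) - cutoff a) / e - - 2 * max 0 (1 - a)) \<le> \<bar>e\<bar>" .
  qed
  show "((\<lambda>e::real. \<bar>e\<bar>) \<longlongrightarrow> 0) (at 0)" by (rule tendsto_rabs_zero) simp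
qed

lemma cutoff_bounds: "0 \<le> cutoff y" "0 \<le> y \<Longrightarrow> cutoff y \<le> 1"
  by (auto simp: cutoff_def max_def power_le_one)

lemma cutoff_pos_iff: "0 < cutoff y \<longleftrightarrow> y < 1"
  by (auto simp: cutoff_def max_def)

lemma cutoff_eq_0: "1 \<le> y \<Longrightarrow> cutoff y = 0"
  by (simp add: cutoff_def)

text \<open>For \<open>k \<le> t \<le> k + 1\<close>, monotonicity puts \<open>g t / t\<close>
  between \<open>g k / (k + 1)\<close> and \<open>g (k + 1) / k\<close>, and the correcting factors
  tend to \<open>1\<close>.\<close>

lemma mono_LIMSEQ_imp_tendsto_at_top:
  fixes g :: "real \<Rightarrow> real"
  assumes mono: "\<And>s t. 0 \<le> s \<Longrightarrow> s \<le> t \<Longrightarrow> g s \<le> g t" and nonneg: "\<And>t. 0 \<le> g t"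
    and lim: "(\<lambda>k. g (real k) / real k) \<longlonglongrightarrow> x"
  shows "((\<lambda>t. g t / t) \<longlongrightarrow> x) at_top"
proof -
  have floor: "filterlim (\<lambda>t::real. nat \<lfloor>t\<rfloor>) sequentially at_top"
    by (rule filterlim_compose[OF filterlim_nat_sequentially filterlim_floor_sequentially])
  have lower: "(\<lambda>k. (g (real k) / real k) * (real k / (real k + 1))) \<longlonglongrightarrow> x * 1"
    by (intro tendsto_mult lim) real_asymp
  have "(\<lambda>k. g (real (Suc k)) / real (Suc k)) \<longlonglongrightarrow> x"
    using lim by (rule LIMSEQ_Suc)
  then have upper: "(\<lambda>k. (g (real (Suc k)) / real (Suc k)) * (real (Suc k) / real k)) \<longlonglongrightarrow> x * 1"
    by (intro tendsto_mult) (auto, real_asymp)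
  have ev: "\<forall>\<^sub>F t::real in at_top. 1 \<le> t" by (rule eventually_ge_at_top)
  show ?thesis
  proof (rule tendsto_sandwich)
    show "((\<lambda>t::real. (g (real (nat \<lfloor>t\<rfloor>)) / real (nat \<lfloor>t\<rfloor>)) * (real (nat \<lfloor>t\<rfloor>) / (real (nat \<lfloor>t\<rfloor>) + 1))) \<longlongrightarrow> x) at_top"
      using filterlim_compose[OF lower floor] by simp
    show "((\<lambda>t::real. (g (real (Suc (nat \<lfloor>t\<rfloor>))) / real (Suc (nat \<lfloor>t\<rfloor>))) * (real (Suc (nat \<lfloor>t\<rfloor>)) / real (nat \<lfloor>t\<rfloor>))) \<longlongrightarrow> x) at_top"
      using filterlim_compose[OF upper floor] by simp
    show "\<forall>\<^sub>F t in at_top. (g (real (nat \<lfloor>t\<rfloor>)) / real (nat \<lfloor>t\<rfloor>)) * (real (nat \<lfloor>t\<rfloor>) / (real (nat \<lfloor>t\<rfloor>) + 1)) \<le> g t / t"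
      using ev
    proof eventually_elim
      case (elim t)
      define k where "k = nat \<lfloor>t\<rfloor>"
      have fl: "1 \<le> real_of_int \<lfloor>t\<rfloor>" "real_of_int \<lfloor>t\<rfloor> \<le> t" "t \<le> real_of_int \<lfloor>t\<rfloor> + 1"
        using elim real_of_int_floor_add_one_ge[of t] by auto
      then have rk: "real k = real_of_int \<lfloor>t\<rfloor>" by (simp add: k_def)
      have k: "1 \<le> real k" "real k \<le> t" "t \<le> real k + 1"
        using rk fl by simp_all
      have "g (real k) / (real k + 1) \<le> g t / t"
        using k mono[of "real k" t] nonneg[of t] nonneg[of "real k"] by (intro frac_le) auto
      then show ?case using k by (simp flip: k_def)
    qed
    show "\<forall>\<^sub>F t in at_top. g t / t \<le> (g (real (Suc (nat \<lfloor>t\<rfloor>))) / real (Suc (nat \<lfloor>t\<rfloor>))) * (real (Suc (nat \<lfloor>t\<rfloor>)) / real (nat \<lfloor>t\<rfloor>))"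
      using ev
    proof eventually_elim
      case (elim t)
      define k where "k = nat \<lfloor>t\<rfloor>"
      have fl: "1 \<le> real_of_int \<lfloor>t\<rfloor>" "real_of_int \<lfloor>t\<rfloor> \<le> t" "t \<le> real_of_int \<lfloor>t\<rfloor> + 1"
        using elim real_of_int_floor_add_one_ge[of t] by auto
      then have rk: "real k = real_of_int \<lfloor>t\<rfloor>" by (simp add: k_def)
      have k: "1 \<le> real k" "real k \<le> t" "t \<le> real k + 1"
        using rk fl by simp_all
      have "g t / t \<le> g (real (Suc k)) / real k"
        using k mono[of t "real (Suc k)"] nonneg by (intro frac_le) auto
      then show ?case using k by (simp flip: k_def del: of_nat_Suc)
    qed
  qed
qed

section \<open>Positivity of the masses\<close>

context self_exciting_process
begin

lemma rate_mono: "0 \<le> t \<Longrightarrow> n \<le> m \<Longrightarrow> rate t n \<le> rate t m"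
  unfolding rate_def using \<gamma>_nonneg
  by (intro mono_onD[OF lam_mono]) (auto intro!: divide_right_mono)

lemma space_in_F: "space M \<in> sets (F s)"
  using sets.top[of "F s"] by (simp add: space_F)

text \<open>With \<open>R\<close> bounding the rate out of \<open>n\<close>,
  \<open>exp (R * u)\<close> is an integrating factor: the inflow is nonnegative and the outflow at
  most \<open>R\<close> times the mass, so the product is nondecreasing.\<close>

lemma mass_pos_later:
  assumes "0 \<le> s" "s \<le> t" "0 < mass (space M) n s"
  shows "0 < mass (space M) n t"
proof -
  have "\<exists>R. \<forall>u\<in>{0..t}. rate u n \<le> R"
    using continuous_attains_sup[of "{0..t}" "\<lambda>u. rate u n"] assms
      continuous_on_subset[OF rate_cont, of "{0..t}"] by fastforce
  then obtain R where R: "\<And>u. u \<in> {0..t} \<Longrightarrow> rate u n \<le> R" by blast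
  let ?g = "\<lambda>u. exp (R * u) * mass (space M) n u"
  have "?g s \<le> ?g t"
  proof (rule DERIV_nonneg_imp_increasing_open[OF assms(2)])
    fix u assume u: "s < u" "u < t"
    define D where "D = (if n = 0 then 0 else rate u (n - 1) * mass (space M) (n - 1) u)
       - rate u n * mass (space M) n u"
    have "(mass (space M) n has_real_derivative D) (at u within {0..t})"
      unfolding D_def using u assms by (intro kolmogorov_forward[OF space_in_F]) auto
    then have "(mass (space M) n has_real_derivative D) (at u)"
      using u assms by (simp add: at_within_Icc_at)
    then have "(?g has_real_derivative exp (R * u) * (R * mass (space M) n u + D)) (at u)"
      by (auto intro!: derivative_eq_intros simp: algebra_simps)
    moreover have "0 \<le> D + rate u n * mass (space M) n u"
      unfolding D_def using u assms by (auto intro!: mult_nonneg_nonneg rate_nonneg mass_nonneg)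
    moreover have "rate u n * mass (space M) n u \<le> R * mass (space M) n u"
      using R[of u] u assms by (intro mult_right_mono mass_nonneg) auto
    ultimately show "\<exists>y. (?g has_real_derivative y) (at u) \<and> 0 \<le> y"
      by (intro exI[of _ "exp (R * u) * (R * mass (space M) n u + D)"]) auto
  next
    show "continuous_on {s..t} ?g"
      using assms by (intro continuous_intros mass_continuous[OF space_in_F])
  qed
  moreover have "0 < ?g s" using assms by simp
  ultimately have "0 < ?g t" by linarith
  then show ?thesis by (simp add: zero_less_mult_iff)
qed

lemma mass_0_pos: "0 \<le> t \<Longrightarrow> 0 < mass (space M) 0 t"
  by (rule mass_pos_later[of 0]) (simp_all add: mass_def N_zero prob_space)

text \<open>
  At early times the rate is still close to \<open>lam \<gamma>\<close> or larger in every state, so one more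
  jump is possible; afterwards the process can stay put.
\<close>

lemma mass_pos:
  assumes "0 < lam \<gamma>" "0 < t"
  shows "0 < mass (space M) n t"
  using assms(2)
proof (induction n arbitrary: t)
  case 0
  then show ?case by (simp add: mass_0_pos)
next
  case (Suc n)
  have "((\<lambda>u. rate u 0) \<longlongrightarrow> rate 0 0) (at 0 within {0..})"
    using rate_cont by (simp add: continuous_on_def)
  moreover have "0 < rate 0 0" using assms(1) by (simp add: rate_def)
  ultimately have "\<forall>\<^sub>F u in at 0 within {0..}. 0 < rate u 0" by (rule order_tendstoD)
  then obtain d where d: "0 < d" "\<And>u. 0 < u \<Longrightarrow> u < d \<Longrightarrow> 0 < rate u 0"
    by (auto simp: eventually_at dist_real_def)
  define u where "u = min d t / 2"
  have u: "0 < u" "u < d" "u < t" using d Suc.prems by (auto simp: u_def)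
  show ?case
  proof (rule ccontr)
    assume "\<not> ?thesis"
    \<comment> \<open>By \<open>mass_pos_later\<close> the mass vanishes at all earlier times too,
      so its derivative at \<open>u\<close> is \<open>0\<close>. But that derivative is the inflow
      \<open>rate u n * mass (space M) n u\<close>, positive by monotonicity of the rate and the
      induction hypothesis.\<close>
    then have zero: "mass (space M) (Suc n) v = 0" if "0 \<le> v" "v \<le> t" for v
      using mass_pos_later[of v t "Suc n"] that mass_nonneg[of "space M" "Suc n" v] by fastforce
    have "(mass (space M) (Suc n) has_real_derivative
        rate u n * mass (space M) n u - rate u (Suc n) * mass (space M) (Suc n) u)
        (at u within {0..t})"
      using kolmogorov_forward[OF space_in_F, of 0 u t "Suc n"] u by simp
    then have "(mass (space M) (Suc n) has_real_derivative rate u n * mass (space M) n u) (at u)"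
      using u zero[of u] by (simp add: at_within_Icc_at)
    then have "rate u n * mass (space M) n u = 0"
    proof (rule DERIV_local_const[of _ _ _ "min u (t - u)"])
      show "\<forall>v. \<bar>u - v\<bar> < min u (t - u) \<longrightarrow>
          mass (space M) (Suc n) u = mass (space M) (Suc n) v"
        using zero u by auto
    qed (use u in simp)
    moreover have "0 < rate u n"
      using d(2)[OF u(1,2)] rate_mono[of u 0 n] u by simp
    ultimately show False using Suc.IH[OF u(1)] by simp
  qed
qed

end

text \<open>Abel summation: it moves the forward operator from the masses to the test function,
  where it becomes the generator. The boundary term carries the factor
  \<open>c (Suc m) = 0\<close>.\<close>

lemma sum_by_parts_shift:
  fixes c g h :: "nat \<Rightarrow> 'b::comm_ring_1"
  assumes "c (Suc m) = 0"
  shows "(\<Sum>n\<le>m. h n + ((if n = 0 then 0 else g (n - 1)) - g n) * c n) =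
    (\<Sum>n\<le>m. h n + g n * (c (Suc n) - c n))"
proof -
  have "(\<Sum>n\<le>k. h n + ((if n = 0 then 0 else g (n - 1)) - g n) * c n) =
      (\<Sum>n\<le>k. h n + g n * (c (Suc n) - c n)) - g k * c (Suc k)" for k
    by (induction k) (simp_all add: algebra_simps)
  with assms show ?thesis by simp
qed

text \<open>\<open>contraction\<close> is the quantitative form of slope below \<open>1\<close> at
  \<open>x\<close>: the ratio \<open>z = (n + \<gamma>) / (t + 1)\<close> has drift
  \<open>(lam z - z) / (t + 1)\<close>, which points towards \<open>x\<close> near \<open>x\<close>.
  \<open>T\<close> is the time from which the path is followed.\<close>

locale stable_fixed_point = self_exciting_process M X lam \<gamma>
  for M :: "'a measure" and X lam \<gamma> +
  fixes x \<delta> \<kappa> :: real and T :: nat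
  assumes x_nonneg: "0 \<le> x" and x_fixed: "lam x = x"
    and \<delta>_pos: "0 < \<delta>" and \<kappa>: "0 < \<kappa>" "\<kappa> < 1"
    and contraction: "0 \<le> z \<Longrightarrow> \<bar>z - x\<bar> \<le> \<delta> \<Longrightarrow> (z - x) * (lam z - z) \<le> - \<kappa> * (z - x)\<^sup>2"
begin

text \<open>
  The summand with \<open>x + \<delta>\<close> absorbs the variance of the jumps, as the rate is at most \<open>x + \<delta>\<close>
  near \<open>x\<close>; the normalisation makes \<open>level n t < 1\<close> imply distance less than \<open>\<delta>\<close> from \<open>x\<close>
  for all \<open>t \<ge> T\<close>.
\<close>

definition level :: "nat \<Rightarrow> real \<Rightarrow> real" where
  "level n t = (t + 1) powr \<kappa> *
     (((real n + \<gamma>) / (t + 1) - x)\<^sup>2 + (x + \<delta>) / ((1 - \<kappa>) * (t + 1))) /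
     (\<delta>\<^sup>2 * (real T + 1) powr \<kappa>)"

text \<open>Written with the prefactor that the jump increments of \<open>level\<close> also carry,
  so that both parts of the generator combine in \<open>level_drift\<close>.\<close>

definition level' :: "nat \<Rightarrow> real \<Rightarrow> real" where
  "level' n t = (t + 1) powr \<kappa> / (t + 1) *
     (\<kappa> * ((real n + \<gamma>) / (t + 1) - x)\<^sup>2
       - 2 * ((real n + \<gamma>) / (t + 1) - x) * ((real n + \<gamma>) / (t + 1)) - (x + \<delta>) / (t + 1)) /
     (\<delta>\<^sup>2 * (real T + 1) powr \<kappa>)"

abbreviation potential :: "real \<Rightarrow> nat \<Rightarrow> real" where
  "potential t n \<equiv> cutoff (level n t)"

lemma level_deriv: "(level n has_real_derivative level' n t) (at t)" if "0 \<le> t"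
proof -
  let ?c = "\<delta>\<^sup>2 * (real T + 1) powr \<kappa>"
  have c: "?c \<noteq> 0" using \<delta>_pos by simp
  have t: "t + 1 \<noteq> 0" "0 < t + 1" using that by auto
  have k: "1 - \<kappa> \<noteq> 0" using \<kappa> by simp
  have p: "((\<lambda>t. (t + 1) powr \<kappa>) has_real_derivative \<kappa> * (t + 1) powr \<kappa> / (t + 1)) (at t)"
    using t by (auto intro!: derivative_eq_intros simp: powr_diff)
  \<comment> \<open>The extra summand of \<open>level\<close> is \<open>C / (t + 1)\<close>.
    Together with the weight \<open>(t + 1) powr \<kappa>\<close> its derivative acquires the factor
    \<open>\<kappa> - 1\<close>, so dividing by \<open>1 - \<kappa>\<close> leaves exactly
    \<open>- (x + \<delta>)\<close>.\<close>
  define C where "C = (x + \<delta>) / (1 - \<kappa>)"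
  have C: "(x + \<delta>) / ((1 - \<kappa>) * s) = C / s" "x + \<delta> = (1 - \<kappa>) * C" for s
    using k by (simp_all add: C_def)
  have r: "((\<lambda>t. b / (t + 1)) has_real_derivative - (b / (t + 1) / (t + 1))) (at t)" for b
    using t by (auto intro!: derivative_eq_intros)
  have sq: "of_nat 2 * ((- p - 0) * w ^ (2 - Suc 0)) + - c = - 2 * w * p - c" for w p c :: real
    by simp
  have q: "((\<lambda>t. ((real n + \<gamma>) / (t + 1) - x)\<^sup>2 + C / (t + 1)) has_real_derivative
      - 2 * ((real n + \<gamma>) / (t + 1) - x) * ((real n + \<gamma>) / (t + 1) / (t + 1))
        - C / (t + 1) / (t + 1)) (at t)"
    by (rule DERIV_cong[OF DERIV_add[OF DERIV_power[OF DERIV_diff[OF r DERIV_const]] r]]) (rule sq)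
  have alg: "\<kappa> * P / s * (y\<^sup>2 + C / s) + (- 2 * y * (z / s) - C / s / s) * P
     = P / s * (\<kappa> * y\<^sup>2 - 2 * y * z - (1 - \<kappa>) * C / s)" for P s y z :: real
    by (simp add: algebra_simps diff_divide_distrib add_divide_distrib)
  show ?thesis
    unfolding level_def[abs_def] level'_def C(1)
    by (rule DERIV_cong[OF DERIV_cdivide[OF DERIV_mult[OF p q]]]) (simp only: alg C(2))
qed

text \<open>Dropping the nonnegative extra summand bounds the weighted square of the distance.
  Comparing the weights at \<open>T\<close> and \<open>t\<close> keeps the path where
  \<open>contraction\<close> applies; dividing by the weight gives the decay that forces
  convergence.\<close>

lemma near_fixed_point:
  assumes "real T \<le> t" "level n t < 1"
  shows "\<bar>(real n + \<gamma>) / (t + 1) - x\<bar> < \<delta>"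
    and "((real n + \<gamma>) / (t + 1) - x)\<^sup>2 < \<delta>\<^sup>2 * (real T + 1) powr \<kappa> * (t + 1) powr (- \<kappa>)"
proof -
  let ?y = "(real n + \<gamma>) / (t + 1) - x"
  let ?P = "(t + 1) powr \<kappa>" and ?c = "\<delta>\<^sup>2 * (real T + 1) powr \<kappa>"
  have t: "0 < t + 1" using assms(1) of_nat_0_le_iff[of T, where 'a = real] by linarith
  have P: "0 < ?P" and c: "0 < ?c" using t \<delta>_pos by simp_all
  have K: "0 \<le> (x + \<delta>) / ((1 - \<kappa>) * (t + 1))"
    using x_nonneg \<delta>_pos \<kappa> t by (intro divide_nonneg_nonneg) auto
  have "?P * (?y\<^sup>2 + (x + \<delta>) / ((1 - \<kappa>) * (t + 1))) < ?c"
    using assms(2) c by (simp add: level_def divide_less_eq)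
  moreover have "?P * ?y\<^sup>2 \<le> ?P * (?y\<^sup>2 + (x + \<delta>) / ((1 - \<kappa>) * (t + 1)))"
    using P K by (intro mult_left_mono) auto
  ultimately have main: "?P * ?y\<^sup>2 < ?c" by linarith
  then show "?y\<^sup>2 < ?c * (t + 1) powr (- \<kappa>)"
    using P by (simp add: powr_minus field_simps)
  have "(real T + 1) powr \<kappa> \<le> ?P" using assms(1) \<kappa> by (intro powr_mono2) auto
  then have "?c \<le> ?P * \<delta>\<^sup>2" by (simp add: mult.commute mult_left_mono)
  with main have "?P * ?y\<^sup>2 < ?P * \<delta>\<^sup>2" by linarith
  then have "\<bar>?y\<bar>\<^sup>2 < \<delta>\<^sup>2" using P by simp
  then show "\<bar>?y\<bar> < \<delta>" by (rule power_less_imp_less_base) (use \<delta>_pos in simp)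
qed

lemma level_nonneg: "0 \<le> t \<Longrightarrow> 0 \<le> level n t"
  unfolding level_def using x_nonneg \<delta>_pos \<kappa>
  by (intro divide_nonneg_nonneg mult_nonneg_nonneg add_nonneg_nonneg) auto

text \<open>So large a state has ratio at least \<open>x + \<delta>\<close>, outside the support;
  hence only finitely many states matter at a given time.\<close>

lemma potential_eq_0:
  assumes "real T \<le> t" "(x + \<delta>) * (t + 1) \<le> real n"
  shows "1 \<le> level n t" "potential t n = 0"
proof -
  have t: "0 < t + 1" using assms(1) of_nat_0_le_iff[of T, where 'a = real] by linarith
  have "x + \<delta> \<le> real n / (t + 1)" using assms(2) t by (simp add: field_simps)
  also have "\<dots> \<le> (real n + \<gamma>) / (t + 1)" using \<gamma>_nonneg t by (intro divide_right_mono) auto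
  finally show "1 \<le> level n t"
    using near_fixed_point(1)[OF assms(1), of n] by (cases "level n t < 1") auto
  then show "potential t n = 0" by (rule cutoff_eq_0)
qed

text \<open>With \<open>z = x + y\<close>, the generator gives, up to a positive factor,
  \<open>\<kappa> * y\<^sup>2 + 2 * (y * (lam z - z)) + (lam z - (x + \<delta>)) / (t + 1)\<close>.
  Contraction bounds the middle term by \<open>- 2 * \<kappa> * y\<^sup>2\<close>, which outweighs
  the growth of the weight, and the last term is nonpositive.\<close>

lemma level_drift:
  assumes "real T \<le> t" "level n t < 1"
  shows "level' n t + rate t n * (level (Suc n) t - level n t) \<le> 0"
proof -
  define y where "y = (real n + \<gamma>) / (t + 1) - x"
  define P where "P = (t + 1) powr \<kappa> / (t + 1) / (\<delta>\<^sup>2 * (real T + 1) powr \<kappa>)"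
  define C where "C = (x + \<delta>) / ((1 - \<kappa>) * (t + 1))"
  have t: "0 < t + 1" using assms(1) of_nat_0_le_iff[of T, where 'a = real] by linarith
  have z: "0 \<le> x + y" using \<gamma>_nonneg t by (simp add: y_def)
  have y: "\<bar>y\<bar> < \<delta>" using near_fixed_point(1)[OF assms] by (simp add: y_def)
  have rate: "rate t n = lam (x + y)" by (simp add: rate_def y_def)
  have contr: "y * (lam (x + y) - (x + y)) \<le> - \<kappa> * y\<^sup>2"
    using contraction[OF z] y by simp
  \<comment> \<open>Above \<open>x\<close> contraction gives \<open>lam z \<le> z\<close>, which is
    below \<open>x + \<delta>\<close>; below \<open>x\<close> monotonicity gives
    \<open>lam z \<le> lam x = x\<close>.\<close>
  have bound: "lam (x + y) \<le> x + \<delta>"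
  proof (cases "0 < y")
    case True
    have "0 \<le> \<kappa> * y\<^sup>2" using \<kappa> by simp
    with contr have "y * (lam (x + y) - (x + y)) \<le> 0" by simp
    with True have "lam (x + y) \<le> x + y" by (simp add: mult_le_0_iff)
    with y show ?thesis by simp
  next
    case False
    then have "lam (x + y) \<le> lam x" using z x_nonneg by (intro mono_onD[OF lam_mono]) auto
    with x_fixed \<delta>_pos show ?thesis by simp
  qed
  have "(real (Suc n) + \<gamma>) / (t + 1) - x = y + 1 / (t + 1)"
    by (simp add: y_def add_divide_distrib)
  then have "level (Suc n) t - level n t = (t + 1) powr \<kappa> * ((y + 1 / (t + 1))\<^sup>2 + C)
     / (\<delta>\<^sup>2 * (real T + 1) powr \<kappa>) - (t + 1) powr \<kappa> * (y\<^sup>2 + C) / (\<delta>\<^sup>2 * (real T + 1) powr \<kappa>)"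
    by (simp only: level_def y_def C_def)
  also have "\<dots> = (t + 1) powr \<kappa> * ((y + 1 / (t + 1))\<^sup>2 - y\<^sup>2)
     / (\<delta>\<^sup>2 * (real T + 1) powr \<kappa>)"
    by (simp only: diff_divide_distrib[symmetric] right_diff_distrib[symmetric] add_diff_cancel_right)
  also have "(y + 1 / (t + 1))\<^sup>2 - y\<^sup>2 = (2 * y + 1 / (t + 1)) / (t + 1)"
    by (simp add: power2_sum add_divide_distrib) (simp add: power2_eq_square)
  finally have incr: "level (Suc n) t - level n t = P * (2 * y + 1 / (t + 1))"
    by (simp add: P_def)
  have "level' n t = P * (\<kappa> * y\<^sup>2 - 2 * y * (x + y) - (x + \<delta>) / (t + 1))"
    by (simp add: level'_def P_def y_def)
  then have "level' n t + rate t n * (level (Suc n) t - level n t) =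
     P * (\<kappa> * y\<^sup>2 + 2 * (y * (lam (x + y) - (x + y))) + (lam (x + y) - (x + \<delta>)) / (t + 1))"
    unfolding incr rate by (simp add: algebra_simps diff_divide_distrib)
  also have "\<dots> \<le> 0"
  proof (rule mult_nonneg_nonpos)
    show "0 \<le> P" using t by (simp add: P_def)
    have "(lam (x + y) - (x + \<delta>)) / (t + 1) \<le> 0"
      using bound t by (simp add: divide_nonpos_pos)
    moreover have "0 \<le> \<kappa> * y\<^sup>2" using \<kappa> by simp
    ultimately show "\<kappa> * y\<^sup>2 + 2 * (y * (lam (x + y) - (x + y))) + (lam (x + y) - (x + \<delta>)) / (t + 1) \<le> 0"
      using contr by linarith
  qed
  finally show ?thesis .
qed

text \<open>By convexity the jump term is at least the slope of \<open>cutoff\<close> times the jump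
  of \<open>level\<close>. The slope is nonpositive and vanishes where \<open>level\<close> is at
  least \<open>1\<close>, so \<open>level_drift\<close> is used only where it holds.\<close>

lemma potential_drift:
  assumes "real T \<le> t"
  shows "0 \<le> - 2 * max 0 (1 - level n t) * level' n t +
    rate t n * (potential t (Suc n) - potential t n)"
proof -
  have t: "0 \<le> t" using assms of_nat_0_le_iff[of T, where 'a = real] by linarith
  have "- 2 * max 0 (1 - level n t) * (level (Suc n) t - level n t)
      \<le> potential t (Suc n) - potential t n"
    using cutoff_taylor(1)[of "level (Suc n) t" "level n t"] by linarith
  then have "rate t n * (- 2 * max 0 (1 - level n t) * (level (Suc n) t - level n t))
      \<le> rate t n * (potential t (Suc n) - potential t n)"
    by (rule mult_left_mono[OF _ rate_nonneg[OF t]])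
  moreover have "0 \<le> - 2 * max 0 (1 - level n t) *
      (level' n t + rate t n * (level (Suc n) t - level n t))"
    using level_drift[OF assms, of n] by (cases "level n t < 1") (auto intro!: mult_nonpos_nonpos)
  ultimately show ?thesis by (simp add: algebra_simps)
qed

text \<open>States above \<open>m\<close> lie outside the support, so the expectation is a finite
  sum that can be differentiated termwise.\<close>

lemma potential_expectation:
  assumes A: "A \<in> sets M" and t: "real T \<le> t" and m: "(x + \<delta>) * (t + 1) \<le> real m"
  shows "(\<integral>\<omega>. indicator A \<omega> * potential t (N t \<omega>) \<partial>M) = (\<Sum>n\<le>m. potential t n * mass A n t)"
proof -
  have ev: "{\<omega>\<in>A. N t \<omega> = n} \<in> sets M" for n
    using restrict_event[OF A, of "\<lambda>_ k. k = n"] by simp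
  have "(\<integral>\<omega>. indicator A \<omega> * potential t (N t \<omega>) \<partial>M) =
     (\<integral>\<omega>. (\<Sum>n\<le>m. potential t n * indicator {\<omega>\<in>A. N t \<omega> = n} \<omega>) \<partial>M)"
  proof (rule Bochner_Integration.integral_cong[OF refl])
    fix \<omega>
    have "(\<Sum>n\<le>m. potential t n * indicator {\<omega>\<in>A. N t \<omega> = n} \<omega>) =
        (\<Sum>n\<le>m. if n = N t \<omega> then indicator A \<omega> * potential t (N t \<omega>) else 0)"
      by (intro sum.cong) (auto simp: indicator_def)
    also have "\<dots> = (if N t \<omega> \<le> m then indicator A \<omega> * potential t (N t \<omega>) else 0)"
      by (simp add: sum.delta)
    also have "\<dots> = indicator A \<omega> * potential t (N t \<omega>)"
    proof (cases "N t \<omega> \<le> m")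
      case False
      then have "potential t (N t \<omega>) = 0"
        using m by (intro potential_eq_0(2)[OF t]) linarith
      with False show ?thesis by simp
    qed simp
    finally show "indicator A \<omega> * potential t (N t \<omega>) =
        (\<Sum>n\<le>m. potential t n * indicator {\<omega>\<in>A. N t \<omega> = n} \<omega>)" ..
  qed
  also have "\<dots> = (\<Sum>n\<le>m. potential t n * mass A n t)"
    by (subst Bochner_Integration.integral_sum)
       (use ev in \<open>auto simp: mass_def less_top[symmetric] intro!: integrable_mult_right integrable_real_indicator\<close>)
  finally show ?thesis .
qed

text \<open>Testing against all \<open>A\<close> known at time \<open>s\<close> is the submartingale
  property. The derivative of the finite sum is, after summation by parts, a combination of the
  drifts in \<open>potential_drift\<close> with the masses as weights.\<close>

lemma potential_submartingale:
  assumes A: "A \<in> sets (F s)" and s: "real T \<le> s" "s \<le> t"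
  shows "(\<integral>\<omega>. indicator A \<omega> * potential s (N s \<omega>) \<partial>M) \<le> (\<integral>\<omega>. indicator A \<omega> * potential t (N t \<omega>) \<partial>M)"
proof -
  have AM: "A \<in> sets M" using A sets_F_subset by blast
  have s0: "0 \<le> s" using s(1) of_nat_0_le_iff[of T, where 'a = real] by linarith
  \<comment> \<open>The support widens with time, so a bound on the states chosen for the final time
    serves all earlier ones.\<close>
  obtain m :: nat where m: "(x + \<delta>) * (t + 1) \<le> real m" using real_arch_simple by blast
  have m': "(x + \<delta>) * (u + 1) \<le> real m" if "u \<le> t" for u
  proof -
    have "(x + \<delta>) * (u + 1) \<le> (x + \<delta>) * (t + 1)"
      using that x_nonneg \<delta>_pos by (intro mult_left_mono) auto
    with m show ?thesis by linarith
  qed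
  let ?S = "\<lambda>u. \<Sum>n\<le>m. potential u n * mass A n u"
  have deriv: "((\<lambda>u. potential u n) has_real_derivative - 2 * max 0 (1 - level n u) * level' n u) (at u)"
    if "0 \<le> u" for u n
    using DERIV_chain2[OF cutoff_deriv level_deriv[OF that]] .
  have "?S s \<le> ?S t"
  proof (rule DERIV_nonneg_imp_increasing_open[OF s(2)])
    fix u assume u: "s < u" "u < t"
    let ?in = "\<lambda>n. if n = 0 then 0 else rate u (n - 1) * mass A (n - 1) u"
    let ?D = "\<Sum>n\<le>m. - 2 * max 0 (1 - level n u) * level' n u * mass A n u +
        (?in n - rate u n * mass A n u) * potential u n"
    have "(mass A n has_real_derivative ?in n - rate u n * mass A n u) (at u)" for n
      using kolmogorov_forward[OF A s0, of u t n] u by (simp add: at_within_Icc_at)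
    then have "(?S has_real_derivative ?D) (at u)"
      using u s0 by (intro DERIV_sum DERIV_mult deriv) auto
    moreover have "0 \<le> ?D"
    proof -
      have "potential u (Suc m) = 0"
        using m'[of u] u s by (intro potential_eq_0(2)) auto
      then have "?D = (\<Sum>n\<le>m. - 2 * max 0 (1 - level n u) * level' n u * mass A n u +
          rate u n * mass A n u * (potential u (Suc n) - potential u n))"
        by (rule sum_by_parts_shift)
      also have "\<dots> = (\<Sum>n\<le>m. (- 2 * max 0 (1 - level n u) * level' n u +
          rate u n * (potential u (Suc n) - potential u n)) * mass A n u)"
        by (rule sum.cong[OF refl]) (simp only: ring_distribs mult_ac)
      also have "0 \<le> \<dots>"
        using u s by (intro sum_nonneg mult_nonneg_nonneg mass_nonneg potential_drift) auto
      finally show ?thesis .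
    qed
    ultimately show "\<exists>y. (?S has_real_derivative y) (at u) \<and> 0 \<le> y" by blast
  next
    have "continuous_on {s..t} (\<lambda>u. potential u n)" for n
      using s0 by (intro continuous_at_imp_continuous_on ballI DERIV_isCont[OF deriv]) auto
    then show "continuous_on {s..t} ?S"
      by (intro continuous_intros mass_continuous[OF A s0])
  qed
  then show ?thesis
    using potential_expectation[OF AM s(1) m'[OF s(2)]] potential_expectation[OF AM _ m] s by simp
qed

section \<open>Convergence with positive probability\<close>

text \<open>Stage \<open>k\<close> tests the times from \<open>T\<close> to \<open>T + k - 1\<close>
  only. Time \<open>T + k\<close> is tested at the next stage, before the submartingale moves on to
  \<open>T + k + 1\<close>.\<close>

fun confined :: "nat \<Rightarrow> nat \<Rightarrow> 'a set" where
  "confined n0 0 = {\<omega>\<in>space M. N (real T) \<omega> = n0}"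
| "confined n0 (Suc k) =
    confined n0 k \<inter> {\<omega>\<in>space M. 0 < potential (real (T + k)) (N (real (T + k)) \<omega>)}"

lemma confined_F: "confined n0 k \<in> sets (F (real (T + k)))"
proof (induction k)
  case 0
  show ?case using N_set_F[of "\<lambda>n. n = n0" "real T"] by simp
next
  case (Suc k)
  have "confined n0 (Suc k) \<in> sets (F (real (T + k)))"
    unfolding confined.simps
    by (rule sets.Int[OF Suc N_set_F[of "\<lambda>n. 0 < potential (real (T + k)) n"]])
  then show ?case using sets_F_mono[of "real (T + k)" "real (T + Suc k)"] by auto
qed

lemma potential_bounds: "0 \<le> t \<Longrightarrow> 0 \<le> potential t n \<and> potential t n \<le> 1"
  by (simp add: cutoff_bounds level_nonneg)

text \<open>
  A discrete form of Ville's maximal inequality: on the part of \<open>confined n0 k\<close> that is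
  discarded the potential vanishes, so discarding it does not change the expectation.
\<close>

lemma prob_confined_ge:
  "mass (space M) n0 (real T) * potential (real T) n0 \<le> prob (confined n0 k)"
proof -
  let ?e = "\<lambda>k. \<integral>\<omega>. indicator (confined n0 k) \<omega> *
    potential (real (T + k)) (N (real (T + k)) \<omega>) \<partial>M"
  have ev: "confined n0 k \<in> sets M" for k using confined_F sets_F_subset by blast
  have step: "?e k \<le> ?e (Suc k)" for k
  proof -
    let ?t = "real (T + k)"
    have "?e k = (\<integral>\<omega>. indicator (confined n0 (Suc k)) \<omega> * potential ?t (N ?t \<omega>) \<partial>M)"
    proof (rule Bochner_Integration.integral_cong[OF refl])
      fix \<omega> assume "\<omega> \<in> space M"
      moreover have "0 \<le> potential ?t (N ?t \<omega>)" by (rule cutoff_bounds)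
      ultimately show "indicator (confined n0 k) \<omega> * potential ?t (N ?t \<omega>) =
          indicator (confined n0 (Suc k)) \<omega> * potential ?t (N ?t \<omega>)"
        by (auto simp: indicator_def less_le)
    qed
    also have "\<dots> \<le> ?e (Suc k)"
    proof (rule potential_submartingale)
      have "confined n0 (Suc k) = confined n0 k \<inter> {\<omega>\<in>space M. 0 < potential ?t (N ?t \<omega>)}"
        by simp
      also have "\<dots> \<in> sets (F ?t)"
        by (rule sets.Int[OF confined_F N_set_F[of "\<lambda>n. 0 < potential ?t n"]])
      finally show "confined n0 (Suc k) \<in> sets (F ?t)" .
    qed auto
    finally show ?thesis .
  qed
  have "?e 0 \<le> ?e k" by (rule lift_Suc_mono_le[of ?e, OF step]) simp
  also have "?e k \<le> (\<integral>\<omega>. indicator (confined n0 k) \<omega> \<partial>M)"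
  proof (rule integral_mono')
    show "integrable M (indicator (confined n0 k) :: _ \<Rightarrow> real)"
      using ev by (simp add: less_top[symmetric])
    fix \<omega>
    show "indicator (confined n0 k) \<omega> * potential (real (T + k)) (N (real (T + k)) \<omega>)
        \<le> indicator (confined n0 k) \<omega>"
      using potential_bounds[of "real (T + k)" "N (real (T + k)) \<omega>"] by (simp add: indicator_def)
  qed simp
  also have "\<dots> = prob (confined n0 k)" using ev by simp
  also have "?e 0 = (\<integral>\<omega>. indicator (confined n0 0) \<omega> * potential (real T) n0 \<partial>M)"
    by (intro Bochner_Integration.integral_cong) (auto simp: indicator_def)
  also have "\<dots> = mass (space M) n0 (real T) * potential (real T) n0"
    using ev[of 0] by (simp add: mass_def)
  finally show ?thesis .
qed

lemma confined_converges:
  assumes "\<omega> \<in> (\<Inter>k. confined n0 k)"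
  shows "(\<lambda>k. real (N (real k) \<omega>) / real k) \<longlonglongrightarrow> x"
proof -
  define y where "y k = (real (N (real k) \<omega>) + \<gamma>) / (real k + 1) - x" for k :: nat
  define c where "c = \<delta>\<^sup>2 * (real T + 1) powr \<kappa>"
  have bound: "(y k)\<^sup>2 \<le> c * (real k + 1) powr (- \<kappa>)" if "T \<le> k" for k
  proof -
    \<comment> \<open>This is the first stage that tests time \<open>k\<close>.\<close>
    have "\<omega> \<in> confined n0 (Suc (k - T))" using assms by blast
    then have "level (N (real k) \<omega>) (real k) < 1"
      using that by (simp add: cutoff_pos_iff)
    from near_fixed_point(2)[OF _ this] that show ?thesis by (simp add: y_def c_def)
  qed
  have "(\<lambda>k. (y k)\<^sup>2) \<longlonglongrightarrow> 0"
  proof (rule tendsto_sandwich[OF _ _ tendsto_const])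
    show "\<forall>\<^sub>F k in sequentially. (y k)\<^sup>2 \<le> c * (real k + 1) powr (- \<kappa>)"
      using bound by (auto simp: eventually_sequentially)
    have "(\<lambda>k. (real k + 1) powr (- \<kappa>)) \<longlonglongrightarrow> 0"
      using \<kappa> by real_asymp
    from tendsto_mult_left[OF this, of c]
    show "(\<lambda>k. c * (real k + 1) powr (- \<kappa>)) \<longlonglongrightarrow> 0" by simp
  qed simp
  from tendsto_real_sqrt[OF this] have "y \<longlonglongrightarrow> 0"
    by (simp add: tendsto_rabs_zero_iff)
  then have "(\<lambda>k. (y k + x) * ((real k + 1) / real k) - \<gamma> / real k) \<longlonglongrightarrow> (0 + x) * 1 - 0"
    by (intro tendsto_intros) (assumption, real_asymp)
  then have "(\<lambda>k. (y k + x) * ((real k + 1) / real k) - \<gamma> / real k) \<longlonglongrightarrow> x" by simp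
  \<comment> \<open>The identity undoes the shifts by \<open>\<gamma>\<close> and \<open>1\<close>;
    it also holds at \<open>k = 0\<close>, where division by zero yields \<open>0\<close> on both
    sides.\<close>
  moreover have "(y k + x) * ((real k + 1) / real k) - \<gamma> / real k = real (N (real k) \<omega>) / real k"
    for k
  proof -
    have "(y k + x) * ((real k + 1) / real k) = (real (N (real k) \<omega>) + \<gamma>) / real k"
      by (simp add: y_def)
    then show ?thesis by (simp add: add_divide_distrib)
  qed
  ultimately show ?thesis by simp
qed

text \<open>The confined events decrease and their probabilities have a common positive lower bound,
  which continuity from above passes to the intersection.\<close>

lemma prob_converges_pos:
  assumes "0 < mass (space M) n0 (real T)" "level n0 (real T) < 1"
  shows "0 < prob {\<omega>\<in>space M. ((\<lambda>t. real (N t \<omega>) / t) \<longlongrightarrow> x) at_top}"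
proof -
  let ?lim = "\<lambda>\<omega>. (\<lambda>k. real (N (real k) \<omega>) / real k) \<longlonglongrightarrow> x"
  have ev: "confined n0 k \<in> sets M" for k using confined_F sets_F_subset by blast
  have "(\<lambda>k. prob (confined n0 k)) \<longlonglongrightarrow> prob (\<Inter>k. confined n0 k)"
    using ev by (intro finite_Lim_measure_decseq decseq_SucI) auto
  then have "mass (space M) n0 (real T) * potential (real T) n0 \<le> prob (\<Inter>k. confined n0 k)"
    by (rule LIMSEQ_le_const) (use prob_confined_ge in blast)
  moreover have "0 < mass (space M) n0 (real T) * potential (real T) n0"
    using assms by (simp add: cutoff_pos_iff)
  moreover have "prob (\<Inter>k. confined n0 k) \<le> prob {\<omega>\<in>space M. ?lim \<omega>}"
  proof (rule finite_measure_mono)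
    have "(\<Inter>k. confined n0 k) \<subseteq> confined n0 0" by blast
    then show "(\<Inter>k. confined n0 k) \<subseteq> {\<omega>\<in>space M. ?lim \<omega>}"
      using confined_converges by auto
    show "{\<omega>\<in>space M. ?lim \<omega>} \<in> sets M" by measurable
  qed
  \<comment> \<open>The limit along integers is a measurable event, being given by countably many
    variables; monotone paths make it the same event as the limit in real time.\<close>
  moreover have "?lim \<omega> \<longleftrightarrow> ((\<lambda>t. real (N t \<omega>) / t) \<longlongrightarrow> x) at_top" if "\<omega> \<in> space M" for \<omega>
  proof
    assume "?lim \<omega>"
    then show "((\<lambda>t. real (N t \<omega>) / t) \<longlongrightarrow> x) at_top"
      by (intro mono_LIMSEQ_imp_tendsto_at_top) (auto intro: N_mono[OF that])
  next
    assume "((\<lambda>t. real (N t \<omega>) / t) \<longlongrightarrow> x) at_top"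
    from filterlim_compose[OF this filterlim_real_sequentially] show "?lim \<omega>" .
  qed
  then have "{\<omega>\<in>space M. ?lim \<omega>} = {\<omega>\<in>space M. ((\<lambda>t. real (N t \<omega>) / t) \<longlongrightarrow> x) at_top}"
    by blast
  ultimately show ?thesis by simp
qed

end

section \<open>Choice of the constants and conclusion\<close>

theorem theorem5:
  fixes M :: "'a measure" and X :: "'a \<Rightarrow> real set"
    and lam lam' :: "real \<Rightarrow> real" and \<gamma> x :: real
  assumes "prob_space M"
    and "\<gamma> \<ge> 0"
    and lam_nonneg: "\<And>y. y \<ge> 0 \<Longrightarrow> lam y \<ge> 0"
    and lam_increasing: "mono_on {0..} lam"
    and lam_deriv: "\<And>y. y \<ge> 0 \<Longrightarrow> (lam has_real_derivative lam' y) (at y within {0..})"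
    and lam'_cont: "continuous_on {0..} lam'"
    and finite_fixed_points: "finite {y. y \<ge> 0 \<and> y = lam y}"
    and fixed_points: "\<And>y. y \<ge> 0 \<Longrightarrow> y = lam y \<Longrightarrow> lam' y < 1 \<or> lam' y > 1"
    and process: "self_exciting M X lam \<gamma>"
    and stable: "x \<ge> 0" "x = lam x" "0 < lam' x" "lam' x < 1"
    and nondegenerate: "lam \<gamma> > 0 \<or> x = 0"
  shows "measure M {\<omega> \<in> space M.
           ((\<lambda>t. real (num_points X {0<..t} \<omega>) / t) \<longlongrightarrow> x) at_top} > 0"
proof -
  interpret prob_space M by fact
  have "continuous_on {0..} lam"
    using DERIV_continuous[OF lam_deriv] by (simp add: continuous_on_eq_continuous_within)
  then interpret self_exciting_process M X lam \<gamma>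
    using assms by unfold_locales auto
  \<comment> \<open>Half of the gap \<open>1 - lam' x\<close>, so that the difference quotients near
    \<open>x\<close> stay below \<open>1 - \<kappa>\<close>.\<close>
  define \<kappa> where "\<kappa> = (1 - lam' x) / 2"
  have \<kappa>: "0 < \<kappa>" "\<kappa> < 1" "lam' x < 1 - \<kappa>" using stable by (auto simp: \<kappa>_def field_simps)
  have "((\<lambda>z. (lam z - lam x) / (z - x)) \<longlongrightarrow> lam' x) (at x within {0..})"
    using lam_deriv[OF stable(1)] by (simp add: has_field_derivative_iff)
  then have "\<forall>\<^sub>F z in at x within {0..}. (lam z - lam x) / (z - x) < 1 - \<kappa>"
    using \<kappa>(3) by (rule order_tendstoD)
  then obtain d where d: "0 < d"
    "\<And>z. 0 \<le> z \<Longrightarrow> z \<noteq> x \<Longrightarrow> \<bar>z - x\<bar> < d \<Longrightarrow> (lam z - lam x) / (z - x) < 1 - \<kappa>"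
    by (auto simp: eventually_at dist_real_def)
  define \<delta> where "\<delta> = d / 2"
  have \<delta>: "0 < \<delta>" "\<delta> < d" using d(1) by (auto simp: \<delta>_def)
  have contraction: "(z - x) * (lam z - z) \<le> - \<kappa> * (z - x)\<^sup>2" if "0 \<le> z" "\<bar>z - x\<bar> \<le> \<delta>" for z
  proof (cases "z = x")
    case False
    have "(lam z - lam x) / (z - x) * (z - x)\<^sup>2 \<le> (1 - \<kappa>) * (z - x)\<^sup>2"
      using d(2)[of z] that \<delta> False by (intro mult_right_mono) auto
    moreover have "(lam z - lam x) / (z - x) * (z - x)\<^sup>2 = (z - x) * (lam z - x)"
      using False stable(2) by (simp add: power2_eq_square)
    ultimately show ?thesis by (simp add: power2_eq_square algebra_simps)
  qed simp
  \<comment> \<open>This dominates the bracket in \<open>level\<close> at time \<open>k\<close> for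
    a state rounded up from \<open>x * (k + 1)\<close>. At time \<open>T\<close> the powers of
    \<open>T + 1\<close> cancel, so \<open>bound T < \<delta>\<^sup>2\<close> suffices for a level
    below \<open>1\<close>.\<close>
  define bound where
    "bound k = ((1 + \<gamma>) / (real k + 1))\<^sup>2 + (x + \<delta>) / (1 - \<kappa>) / (real k + 1)" for k :: nat
  have "(\<lambda>k. 1 / (real k + 1)) \<longlonglongrightarrow> 0" by real_asymp
  then have "(\<lambda>k. ((1 + \<gamma>) * (1 / (real k + 1)))\<^sup>2 + (x + \<delta>) / (1 - \<kappa>) * (1 / (real k + 1)))
      \<longlonglongrightarrow> ((1 + \<gamma>) * 0)\<^sup>2 + (x + \<delta>) / (1 - \<kappa>) * 0"
    by (intro tendsto_intros)
  then have "bound \<longlonglongrightarrow> 0" by (simp add: bound_def[abs_def])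
  then have "\<forall>\<^sub>F k in sequentially. bound k < \<delta>\<^sup>2" using \<delta> by (intro order_tendstoD(2)) auto
  then obtain T0 where "\<And>k. T0 \<le> k \<Longrightarrow> bound k < \<delta>\<^sup>2"
    by (auto simp: eventually_sequentially)
  \<comment> \<open>\<open>1 \<le> T\<close> makes the starting time positive, as
    \<open>mass_pos\<close> requires.\<close>
  then obtain T where T: "bound T < \<delta>\<^sup>2" "1 \<le> T"
    using that[of "max T0 1"] by simp
  interpret stable_fixed_point M X lam \<gamma> x \<delta> \<kappa> T
    using stable \<kappa> \<delta> contraction by unfold_locales auto
  \<comment> \<open>Rounding up keeps the deviation of the starting ratio from \<open>x\<close>
    between \<open>0\<close> and \<open>(1 + \<gamma>) / (T + 1)\<close>, and gives
    \<open>n0 = 0\<close> if \<open>x = 0\<close>.\<close>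
  define n0 where "n0 = nat \<lceil>x * (real T + 1)\<rceil>"
  have n0: "x * (real T + 1) \<le> real n0" "real n0 \<le> x * (real T + 1) + 1"
    using stable(1) unfolding n0_def by (auto simp: real_nat_ceiling_ge)
  have "0 < mass (space M) n0 (real T)"
  proof (cases "x = 0")
    case True
    then show ?thesis using mass_0_pos[of "real T"] by (simp add: n0_def)
  next
    case False
    then show ?thesis using nondegenerate T(2) by (intro mass_pos) auto
  qed
  moreover have "level n0 (real T) < 1"
  proof -
    let ?y = "(real n0 + \<gamma>) / (real T + 1) - x"
    have y: "?y = (real n0 + \<gamma> - x * (real T + 1)) / (real T + 1)" by (simp add: field_simps)
    have "0 \<le> ?y" "?y \<le> (1 + \<gamma>) / (real T + 1)"
      unfolding y using n0 \<gamma>_nonneg by (auto intro!: divide_right_mono)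
    then have "?y\<^sup>2 \<le> ((1 + \<gamma>) / (real T + 1))\<^sup>2" by (rule power_mono[rotated])
    then have "?y\<^sup>2 + (x + \<delta>) / ((1 - \<kappa>) * (real T + 1)) < \<delta>\<^sup>2"
      using T(1) by (simp add: bound_def)
    then show ?thesis using \<delta> by (simp add: level_def mult.commute divide_less_eq)
  qed
  ultimately show ?thesis using prob_converges_pos by (simp add: N_def)
qed

end
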